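(* Let $N$ be a $6$-dimensional manifold endowed with an $SU(3)$-structure $(\omega,\psi)$, $\psi = \psi_+ + i\psi_-$, in the class $\mathcal{W}_2^+$, with intrinsic torsion component $\pi_2$. If $\pi_2$ is closed, then the $SU(3)$-structure is integrable. In particular, the associated Riemannian metric $g$ is Ricci flat.
   Context: An $SU(3)$-structure on a $6$-manifold $N$ is given by a Riemannian metric $g$, an orthogonal almost complex structure $J$ with fundamental form $\omega(X,Y) = g(JX,Y)$, and a complex volume form $\psi = \psi_+ + i\psi_-$ of unit norm; locally there is an orthonormal coframe $(e^1,\dots,e^6)$ with $\omega = e^{12}+e^{34}+e^{56}$ and $\psi = (e^1+ie^2)\wedge(e^3+ie^4)\wedge(e^5+ie^6)$, where $e^{ij} = e^i\wedge e^j$. The $SU(3)$-structure is in the class $\mathcal{W}_2^+$ if $$d\omega = 0,\qquad d\psi_- = 0,\qquad d\psi_+ = -\pi_2\wedge\omega,$$ where the $2$-form $\pi_2$ on $N$ (the only possibly non-zero component of the intrinsic torsion) takes values in $\{\gamma\in\Lambda^2 : J\gamma = \gamma,\ \gamma\wedge\omega^2 = 0\}$, with $(J\gamma)(X,Y) = \gamma(JX,JY)$. The $SU(3)$-structure is integrable if its intrinsic torsion vanishes, equivalently if $d\omega = 0$ and $d\psi_+ = d\psi_- = 0$ (so that the holonomy group of the Levi-Civita connection of $g$ reduces to $SU(3)$). *)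

theory Defs
  imports "HOL-Analysis.Analysis" "HOL-Combinatorics.Permutations"
begin

section \<open>Smooth maps and smooth manifolds\<close>

text \<open>The domain \<open>S\<close> is always open below, so the derivatives at points of \<open>S\<close> are unique.\<close>

primrec times_cont_diff_on ::
    "nat \<Rightarrow> ('a::real_normed_vector \<Rightarrow> 'b::real_normed_vector) \<Rightarrow> 'a set \<Rightarrow> bool" where
  "times_cont_diff_on 0 f S \<longleftrightarrow> continuous_on S f"
| "times_cont_diff_on (Suc k) f S \<longleftrightarrow>
     (\<forall>x\<in>S. f differentiable (at x)) \<and>
     (\<forall>v. times_cont_diff_on k (\<lambda>x. frechet_derivative f (at x) v) S)"

definition smooth_map_on ::
    "('a::real_normed_vector \<Rightarrow> 'b::real_normed_vector) \<Rightarrow> 'a set \<Rightarrow> bool" where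
  "smooth_map_on f S \<longleftrightarrow> (\<forall>k. times_cont_diff_on k f S)"

type_synonym ('a, 'n) chart = "'a set \<times> ('a \<Rightarrow> real^'n)"

definition chart_image :: "('a, 'n::finite) chart \<Rightarrow> (real^'n) set" where
  "chart_image c = snd c ` fst c"

definition overlap :: "('a, 'n::finite) chart \<Rightarrow> ('a, 'n) chart \<Rightarrow> (real^'n) set" where
  "overlap c c' = snd c ` (fst c \<inter> fst c')"

definition transition :: "('a, 'n::finite) chart \<Rightarrow> ('a, 'n) chart \<Rightarrow> real^'n \<Rightarrow> real^'n" where
  "transition c c' = snd c' \<circ> inv_into (fst c) (snd c)"

definition smooth_manifold :: "'a topology \<Rightarrow> ('a, 'n::finite) chart set \<Rightarrow> bool" where
  "smooth_manifold X A \<longleftrightarrow>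
     Hausdorff_space X \<and> second_countable X \<and>
     (\<Union>c\<in>A. fst c) = topspace X \<and>
     (\<forall>c\<in>A. openin X (fst c) \<and> open (chart_image c) \<and>
        homeomorphic_map (subtopology X (fst c)) (top_of_set (chart_image c)) (snd c)) \<and>
     (\<forall>c\<in>A. \<forall>c'\<in>A. smooth_map_on (transition c c') (overlap c c'))"


section \<open>Exterior algebra of a vector space\<close>

text \<open>A \<open>k\<close>-linear form is a function on lists of vectors; only its values on lists of length
  \<open>k\<close> matter.\<close>

definition multilinear_form :: "nat \<Rightarrow> ('v::real_vector list \<Rightarrow> 'b::real_vector) \<Rightarrow> bool" where
  "multilinear_form k T \<longleftrightarrow> (\<forall>vs. length vs = k \<longrightarrow> (\<forall>i<k. linear (\<lambda>v. T (vs[i := v]))))"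

definition alternating_form :: "nat \<Rightarrow> ('v::real_vector list \<Rightarrow> 'b::real_vector) \<Rightarrow> bool" where
  "alternating_form k T \<longleftrightarrow>
     multilinear_form k T \<and> (\<forall>vs. length vs = k \<and> \<not> distinct vs \<longrightarrow> T vs = 0)"

text \<open>The wedge product of a \<open>p\<close>-form and a \<open>q\<close>-form, normalised so that
  \<open>(e \<and> f) [u, v] = e u * f v - e v * f u\<close> for 1-forms.\<close>

definition wedge :: "nat \<Rightarrow> nat \<Rightarrow> ('v list \<Rightarrow> 'b::field_char_0) \<Rightarrow> ('v list \<Rightarrow> 'b) \<Rightarrow> 'v list \<Rightarrow> 'b" where
  "wedge p q \<alpha> \<beta> vs =
     (1 / (fact p * fact q)) *
     (\<Sum>\<sigma> | \<sigma> permutes {..<p + q}.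
        of_int (sign \<sigma>) * \<alpha> (map (\<lambda>i. vs ! \<sigma> i) [0..<p]) * \<beta> (map (\<lambda>i. vs ! \<sigma> i) [p..<p + q]))"

text \<open>The natural action of an endomorphism on covariant tensors, by derivations.\<close>

definition endo_act :: "('v \<Rightarrow> 'v) \<Rightarrow> ('v list \<Rightarrow> 'b::real_vector) \<Rightarrow> 'v list \<Rightarrow> 'b" where
  "endo_act B T vs = - (\<Sum>j<length vs. T (vs[j := B (vs ! j)]))"


section \<open>Tensor fields and differential forms\<close>

text \<open>A covariant tensor field is given by its coordinate expressions: \<open>T c x vs\<close> is its value, at
  the point with coordinates \<open>x\<close> in the chart \<open>c\<close>, on the tangent vectors whose components in
  that chart are \<open>vs\<close>. Expressions in different charts are related by pullback along the transition
  maps. Values of \<open>T c x\<close> for \<open>x\<close> outside \<open>chart_image c\<close> are irrelevant.\<close>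

type_synonym ('a, 'n, 'b) tensor = "('a, 'n) chart \<Rightarrow> real^'n \<Rightarrow> (real^'n) list \<Rightarrow> 'b"

definition tensor_field ::
    "('a, 'n::finite) chart set \<Rightarrow> nat \<Rightarrow> ('a, 'n, 'b::real_normed_vector) tensor \<Rightarrow> bool" where
  "tensor_field A k T \<longleftrightarrow>
     (\<forall>c\<in>A. \<forall>x\<in>chart_image c. multilinear_form k (T c x)) \<and>
     (\<forall>c\<in>A. \<forall>vs. length vs = k \<longrightarrow> smooth_map_on (\<lambda>x. T c x vs) (chart_image c)) \<and>
     (\<forall>c\<in>A. \<forall>c'\<in>A. \<forall>x\<in>overlap c c'. \<forall>vs. length vs = k \<longrightarrow>
        T c x vs = T c' (transition c c' x)
          (map (frechet_derivative (transition c c') (at x)) vs))"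

definition differential_form ::
    "('a, 'n::finite) chart set \<Rightarrow> nat \<Rightarrow> ('a, 'n, 'b::real_normed_vector) tensor \<Rightarrow> bool" where
  "differential_form A k \<alpha> \<longleftrightarrow>
     tensor_field A k \<alpha> \<and> (\<forall>c\<in>A. \<forall>x\<in>chart_image c. alternating_form k (\<alpha> c x))"

definition tensor_eq ::
    "('a, 'n::finite) chart set \<Rightarrow> nat \<Rightarrow> ('a, 'n, 'b) tensor \<Rightarrow> ('a, 'n, 'b) tensor \<Rightarrow> bool" where
  "tensor_eq A k \<alpha> \<beta> \<longleftrightarrow>
     (\<forall>c\<in>A. \<forall>x\<in>chart_image c. \<forall>vs. length vs = k \<longrightarrow> \<alpha> c x vs = \<beta> c x vs)"

definition wedge_field ::
    "nat \<Rightarrow> nat \<Rightarrow> ('a, 'n::finite, 'b::field_char_0) tensor \<Rightarrow> ('a, 'n, 'b) tensor \<Rightarrow> ('a, 'n, 'b) tensor" where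
  "wedge_field p q \<alpha> \<beta> c x = wedge p q (\<alpha> c x) (\<beta> c x)"

text \<open>In coordinates, \<open>d\<alpha>(v\<^sub>0,\<dots>,v\<^sub>k)\<close> is the alternating sum of the derivatives in
  direction \<open>v\<^sub>i\<close> of \<open>\<alpha>(v\<^sub>0,\<dots>,v\<^sub>k)\<close> with \<open>v\<^sub>i\<close> omitted, the \<open>v\<^sub>j\<close> being constant.\<close>

definition ext_deriv ::
    "('a, 'n::finite, 'b::real_normed_vector) tensor \<Rightarrow> ('a, 'n, 'b) tensor" where
  "ext_deriv \<alpha> c x vs =
     (\<Sum>i<length vs. (-1) ^ i *\<^sub>R
        frechet_derivative (\<lambda>y. \<alpha> c y (take i vs @ drop (Suc i) vs)) (at x) (vs ! i))"

definition closed_form ::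
    "('a, 'n::finite) chart set \<Rightarrow> nat \<Rightarrow> ('a, 'n, 'b::real_normed_vector) tensor \<Rightarrow> bool" where
  "closed_form A k \<alpha> \<longleftrightarrow> tensor_eq A (Suc k) (ext_deriv \<alpha>) (\<lambda>c x vs. 0)"


section \<open>Riemannian metrics\<close>

definition riemannian_metric ::
    "('a, 'n::finite) chart set \<Rightarrow> ('a, 'n, real) tensor \<Rightarrow> bool" where
  "riemannian_metric A g \<longleftrightarrow>
     tensor_field A 2 g \<and>
     (\<forall>c\<in>A. \<forall>x\<in>chart_image c.
        (\<forall>u v. g c x [u, v] = g c x [v, u]) \<and> (\<forall>v. v \<noteq> 0 \<longrightarrow> 0 < g c x [v, v]))"

definition partial_deriv ::
    "'n::finite \<Rightarrow> (real^'n \<Rightarrow> 'b::real_normed_vector) \<Rightarrow> real^'n \<Rightarrow> 'b" where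
  "partial_deriv i f x = frechet_derivative f (at x) (axis i 1)"

definition gram :: "('a, 'n::finite, real) tensor \<Rightarrow> ('a, 'n) chart \<Rightarrow> real^'n \<Rightarrow> real^'n^'n" where
  "gram g c x = (\<chi> i j. g c x [axis i 1, axis j 1])"

text \<open>\<open>christoffel g c x k i j\<close> is the symbol \<open>\<Gamma>\<close> with upper index \<open>k\<close> and lower indices
  \<open>i, j\<close> of the Levi-Civita connection of \<open>g\<close>.\<close>

definition christoffel ::
    "('a, 'n::finite, real) tensor \<Rightarrow> ('a, 'n) chart \<Rightarrow> real^'n \<Rightarrow> 'n \<Rightarrow> 'n \<Rightarrow> 'n \<Rightarrow> real" where
  "christoffel g c x k i j =
     (1 / 2) * (\<Sum>l\<in>UNIV. matrix_inv (gram g c x) $ k $ l *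
       (partial_deriv i (\<lambda>y. gram g c y $ j $ l) x
        + partial_deriv j (\<lambda>y. gram g c y $ i $ l) x
        - partial_deriv l (\<lambda>y. gram g c y $ i $ j) x))"

definition christoffel_map ::
    "('a, 'n::finite, real) tensor \<Rightarrow> ('a, 'n) chart \<Rightarrow> real^'n \<Rightarrow> real^'n \<Rightarrow> real^'n \<Rightarrow> real^'n" where
  "christoffel_map g c x u v =
     (\<chi> k. \<Sum>i\<in>UNIV. \<Sum>j\<in>UNIV. christoffel g c x k i j * u $ i * v $ j)"

text \<open>\<open>cov_deriv g T c x u\<close> is the Levi-Civita covariant derivative of \<open>T\<close> in direction \<open>u\<close>.\<close>

definition cov_deriv ::
    "('a, 'n::finite, real) tensor \<Rightarrow> ('a, 'n, 'b::real_normed_vector) tensor \<Rightarrow>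
     ('a, 'n) chart \<Rightarrow> real^'n \<Rightarrow> real^'n \<Rightarrow> (real^'n) list \<Rightarrow> 'b" where
  "cov_deriv g T c x u vs =
     frechet_derivative (\<lambda>y. T c y vs) (at x) u + endo_act (christoffel_map g c x u) (T c x) vs"

definition ricci ::
    "('a, 'n::finite, real) tensor \<Rightarrow> ('a, 'n) chart \<Rightarrow> real^'n \<Rightarrow> 'n \<Rightarrow> 'n \<Rightarrow> real" where
  "ricci g c x j k =
     (\<Sum>i\<in>UNIV. partial_deriv i (\<lambda>y. christoffel g c y i j k) x
              - partial_deriv j (\<lambda>y. christoffel g c y i i k) x)
     + (\<Sum>i\<in>UNIV. \<Sum>m\<in>UNIV.
          christoffel g c x i i m * christoffel g c x m j k
          - christoffel g c x i j m * christoffel g c x m i k)"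

definition ricci_flat :: "('a, 'n::finite) chart set \<Rightarrow> ('a, 'n, real) tensor \<Rightarrow> bool" where
  "ricci_flat A g \<longleftrightarrow> (\<forall>c\<in>A. \<forall>x\<in>chart_image c. \<forall>j k. ricci g c x j k = 0)"


section \<open>SU(3)-structures on 6-manifolds\<close>

type_synonym ('a, 'n) endo_field = "('a, 'n) chart \<Rightarrow> real^'n \<Rightarrow> real^'n \<Rightarrow> real^'n"

definition almost_complex_structure ::
    "('a, 'n::finite) chart set \<Rightarrow> ('a, 'n) endo_field \<Rightarrow> bool" where
  "almost_complex_structure A J \<longleftrightarrow>
     (\<forall>c\<in>A. \<forall>x\<in>chart_image c. linear (J c x) \<and> (\<forall>v. J c x (J c x v) = - v)) \<and>
     (\<forall>c\<in>A. \<forall>v. smooth_map_on (\<lambda>x. J c x v) (chart_image c)) \<and>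
     (\<forall>c\<in>A. \<forall>c'\<in>A. \<forall>x\<in>overlap c c'. \<forall>v.
        frechet_derivative (transition c c') (at x) (J c x v) =
        J c' (transition c c' x) (frechet_derivative (transition c c') (at x) v))"

definition fundamental_form ::
    "('a, 'n::finite, real) tensor \<Rightarrow> ('a, 'n) endo_field \<Rightarrow> ('a, 'n, real) tensor" where
  "fundamental_form g J c x vs = g c x [J c x (vs ! 0), vs ! 1]"

definition re_part :: "('a, 'n, complex) tensor \<Rightarrow> ('a, 'n, real) tensor" where
  "re_part \<psi> c x vs = Re (\<psi> c x vs)"

definition im_part :: "('a, 'n, complex) tensor \<Rightarrow> ('a, 'n, real) tensor" where
  "im_part \<psi> c x vs = Im (\<psi> c x vs)"

text \<open>\<open>e 1, \<dots>, e 6\<close> is a smooth local coframe on \<open>W\<close> (inside the image of the chart \<open>c\<close>) which is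
  orthonormal, with \<open>\<omega> = e\<^sup>1\<^sup>2 + e\<^sup>3\<^sup>4 + e\<^sup>5\<^sup>6\<close> and
  \<open>\<psi> = (e\<^sup>1 + i e\<^sup>2) \<and> (e\<^sup>3 + i e\<^sup>4) \<and> (e\<^sup>5 + i e\<^sup>6)\<close>.\<close>

definition adapted_coframe ::
    "('a, 6, real) tensor \<Rightarrow> ('a, 6) endo_field \<Rightarrow> ('a, 6, complex) tensor \<Rightarrow> ('a, 6) chart \<Rightarrow>
     (real^6) set \<Rightarrow> (nat \<Rightarrow> real^6 \<Rightarrow> (real^6) list \<Rightarrow> real) \<Rightarrow> bool" where
  "adapted_coframe g J \<psi> c W e \<longleftrightarrow>
     (\<forall>i\<in>{1..6}. \<forall>x\<in>W. multilinear_form 1 (e i x)) \<and>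
     (\<forall>i\<in>{1..6}. \<forall>v. smooth_map_on (\<lambda>x. e i x [v]) W) \<and>
     (\<forall>x\<in>W.
        (\<forall>u v. g c x [u, v] = (\<Sum>i=1..6. e i x [u] * e i x [v])) \<and>
        (\<forall>vs. length vs = 2 \<longrightarrow> fundamental_form g J c x vs =
           wedge 1 1 (e 1 x) (e 2 x) vs + wedge 1 1 (e 3 x) (e 4 x) vs
           + wedge 1 1 (e 5 x) (e 6 x) vs) \<and>
        (\<forall>vs. length vs = 3 \<longrightarrow> \<psi> c x vs =
           wedge 1 2 (\<lambda>us. Complex (e 1 x us) (e 2 x us))
             (wedge 1 1 (\<lambda>us. Complex (e 3 x us) (e 4 x us))
                        (\<lambda>us. Complex (e 5 x us) (e 6 x us))) vs))"

definition su3_structure ::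
    "('a, 6) chart set \<Rightarrow> ('a, 6, real) tensor \<Rightarrow> ('a, 6) endo_field \<Rightarrow> ('a, 6, complex) tensor \<Rightarrow> bool" where
  "su3_structure A g J \<psi> \<longleftrightarrow>
     riemannian_metric A g \<and>
     almost_complex_structure A J \<and>
     (\<forall>c\<in>A. \<forall>x\<in>chart_image c. \<forall>u v. g c x [J c x u, J c x v] = g c x [u, v]) \<and>
     differential_form A 3 \<psi> \<and>
     (\<forall>c\<in>A. \<forall>x\<in>chart_image c. \<exists>W e.
        open W \<and> x \<in> W \<and> W \<subseteq> chart_image c \<and> adapted_coframe g J \<psi> c W e)"

definition su3_W2_plus ::
    "('a, 6) chart set \<Rightarrow> ('a, 6, real) tensor \<Rightarrow> ('a, 6) endo_field \<Rightarrow> ('a, 6, complex) tensor \<Rightarrow>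
     ('a, 6, real) tensor \<Rightarrow> bool" where
  "su3_W2_plus A g J \<psi> \<pi>\<^sub>2 \<longleftrightarrow> (let \<omega> = fundamental_form g J in
     differential_form A 2 \<pi>\<^sub>2 \<and>
     (\<forall>c\<in>A. \<forall>x\<in>chart_image c. \<forall>u v. \<pi>\<^sub>2 c x [J c x u, J c x v] = \<pi>\<^sub>2 c x [u, v]) \<and>
     tensor_eq A 6 (wedge_field 2 4 \<pi>\<^sub>2 (wedge_field 2 2 \<omega> \<omega>)) (\<lambda>c x vs. 0) \<and>
     closed_form A 2 \<omega> \<and>
     closed_form A 3 (im_part \<psi>) \<and>
     tensor_eq A 4 (ext_deriv (re_part \<psi>)) (\<lambda>c x vs. - wedge_field 2 2 \<pi>\<^sub>2 \<omega> c x vs))"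

text \<open>The Lie algebra \<open>so(6)\<close> and its subalgebra \<open>su(3)\<close>, as endomorphisms of the tangent space at
  the point with coordinates \<open>x\<close> in the chart \<open>c\<close>.\<close>

definition so_alg :: "('a, 'n::finite, real) tensor \<Rightarrow> ('a, 'n) chart \<Rightarrow> real^'n \<Rightarrow> (real^'n \<Rightarrow> real^'n) set" where
  "so_alg g c x = {B. linear B \<and> (\<forall>u v. g c x [B u, v] = - g c x [u, B v])}"

definition su3_alg ::
    "('a, 6, real) tensor \<Rightarrow> ('a, 6) endo_field \<Rightarrow> ('a, 6, complex) tensor \<Rightarrow> ('a, 6) chart \<Rightarrow>
     real^6 \<Rightarrow> (real^6 \<Rightarrow> real^6) set" where
  "su3_alg g J \<psi> c x = {B \<in> so_alg g c x.
     (\<forall>vs. length vs = 2 \<longrightarrow> endo_act B (fundamental_form g J c x) vs = 0) \<and>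
     (\<forall>vs. length vs = 3 \<longrightarrow> endo_act B (\<psi> c x) vs = 0)}"

text \<open>The intrinsic torsion is the unique field \<open>\<xi>\<close> of 1-forms with values in the orthogonal
  complement of \<open>su(3)\<close> in \<open>so(6)\<close> such that \<open>\<nabla> + \<xi>\<close> is an \<open>SU(3)\<close>-connection, where \<open>\<nabla>\<close> is the
  Levi-Civita connection. Orthogonality is with respect to the invariant inner product
  \<open>- tr (B C)\<close>.\<close>

definition intrinsic_torsion ::
    "('a, 6) chart set \<Rightarrow> ('a, 6, real) tensor \<Rightarrow> ('a, 6) endo_field \<Rightarrow> ('a, 6, complex) tensor \<Rightarrow>
     (('a, 6) chart \<Rightarrow> real^6 \<Rightarrow> real^6 \<Rightarrow> real^6 \<Rightarrow> real^6) \<Rightarrow> bool" where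
  "intrinsic_torsion A g J \<psi> \<xi> \<longleftrightarrow>
     (\<forall>c\<in>A. \<forall>x\<in>chart_image c. \<forall>u.
        \<xi> c x u \<in> so_alg g c x \<and>
        (\<forall>B\<in>su3_alg g J \<psi> c x. trace (matrix (\<xi> c x u \<circ> B)) = 0) \<and>
        (\<forall>vs. length vs = 2 \<longrightarrow>
           cov_deriv g (fundamental_form g J) c x u vs
           + endo_act (\<xi> c x u) (fundamental_form g J c x) vs = 0) \<and>
        (\<forall>vs. length vs = 3 \<longrightarrow>
           cov_deriv g \<psi> c x u vs + endo_act (\<xi> c x u) (\<psi> c x) vs = 0))"

definition su3_integrable ::
    "('a, 6) chart set \<Rightarrow> ('a, 6, real) tensor \<Rightarrow> ('a, 6) endo_field \<Rightarrow> ('a, 6, complex) tensor \<Rightarrow> bool" where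
  "su3_integrable A g J \<psi> \<longleftrightarrow> intrinsic_torsion A g J \<psi> (\<lambda>c x u v. 0)"

end

theory Submission
  imports Defs
begin

text \<open>Since \<open>\<pi>\<^sub>2\<close> has type (1,1), \<open>\<pi>\<^sub>2 \<and> \<psi>\<^sub>+ = 0\<close>. Differentiating, and using \<open>d\<pi>\<^sub>2 = 0\<close> and
  \<open>d\<psi>\<^sub>+ = - \<pi>\<^sub>2 \<and> \<omega>\<close>, gives \<open>\<pi>\<^sub>2 \<and> \<pi>\<^sub>2 \<and> \<omega> = 0\<close>; as \<open>\<pi>\<^sub>2\<close> is primitive of type (1,1), this
  6-form is \<open>- \<bar>\<pi>\<^sub>2\<bar>\<^sup>2\<close> times the volume form, so \<open>\<pi>\<^sub>2 = 0\<close>. Hence \<open>d\<omega> = 0\<close> and \<open>d\<psi> = 0\<close>. In an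
  adapted coframe the covariant derivatives \<open>\<nabla>e\<^sup>i\<close> form 1-forms with values in \<open>so(6)\<close>, and the closedness
  equations are linear equations on them which force the values into \<open>su(3)\<close>, i.e. \<open>\<nabla>\<omega> = 0\<close> and
  \<open>\<nabla>\<psi> = 0\<close>. Then the curvature tensor takes values in \<open>su(3)\<close>, and the Bianchi identity makes the
  Ricci tensor vanish.\<close>

section \<open>Calculus\<close>

text \<open>The argument is carried out at one point \<open>x\<close> of one chart. The vectors
  \<open>F 1\<close> to \<open>F 6\<close> are dual to the coframe at \<open>x\<close> and constant
  in the chart, so only the coframe is differentiated, never a frame field. The derivatives of
  \<open>e\<^sup>i\<close> on \<open>F j\<close> in direction \<open>F k\<close> form an array
  \<open>B k i j\<close>, and d\<omega> and d\<psi> at \<open>x\<close> are linear in it.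
  Subtracting \<open>e\<^sup>i\<close> of the Christoffel term gives the array \<open>A\<close> of
  covariant derivatives. The two differ by something symmetric in \<open>k\<close> and
  \<open>j\<close>, which antisymmetrisation kills, so either array may be used: \<open>B\<close>
  for the vanishing of the torsion form, \<open>A\<close>, which is skew in \<open>i\<close> and
  \<open>j\<close>, for the passage from closed to parallel. The Leibniz rule for d of a wedge
  product is replaced by differentiating the type condition \<pi>(Ju, Jv) = \<pi>(u, v) in frame
  components. Away from \<open>x\<close> the vectors J F are no longer signed frame vectors, hence
  the correction terms \<open>dJ\<close>. The second passage is a linear system: 6 directions times
  7 = 15 - 8 components transverse to \<open>su(3)\<close> give 42 unknown combinations, against the
  20 + 30 real components of d\<omega> and d\<psi>.\<close>

lemma smooth_map_on_differentiable:
  assumes "smooth_map_on f S" "x \<in> S"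
  shows "f differentiable (at x)"
proof -
  have "times_cont_diff_on (Suc 0) f S"
    using assms(1) unfolding smooth_map_on_def by blast
  then show ?thesis using assms(2) by simp
qed

lemma smooth_map_on_frechet_derivative:
  assumes "smooth_map_on f S"
  shows "smooth_map_on (\<lambda>x. frechet_derivative f (at x) v) S"
  unfolding smooth_map_on_def
proof
  fix k
  have "times_cont_diff_on (Suc k) f S"
    using assms unfolding smooth_map_on_def by blast
  then show "times_cont_diff_on k (\<lambda>x. frechet_derivative f (at x) v) S" by simp
qed

lemma smooth_map_on_continuous:
  assumes "smooth_map_on f S"
  shows "continuous_on S f"
proof -
  have "times_cont_diff_on 0 f S"
    using assms unfolding smooth_map_on_def by blast
  then show ?thesis by simp
qed

lemma frechet_derivative_eqI:
  assumes "(f has_derivative f') (at x)"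
  shows "frechet_derivative f (at x) = f'"
  using frechet_derivative_at[OF assms] by simp

lemma frechet_derivative_cong_open:
  assumes "open U" "x \<in> U" "\<And>y. y \<in> U \<Longrightarrow> f y = h y"
  shows "frechet_derivative f (at x) = frechet_derivative h (at x)"
proof -
  have "(f has_derivative f') (at x) \<longleftrightarrow> (h has_derivative f') (at x)" for f'
    using assms by (auto elim: has_derivative_transform_within_open)
  then show ?thesis unfolding frechet_derivative_def by simp
qed

lemma differentiable_cong_open:
  assumes "open U" "x \<in> U" "\<And>y. y \<in> U \<Longrightarrow> f y = h y" "f differentiable (at x)"
  shows "h differentiable (at x)"
  using assms by (meson differentiable_def has_derivative_transform_within_open)

text \<open>The mean value theorem in direction \<open>u\<close>, then in direction
  \<open>w\<close>. The second difference is symmetric in \<open>u\<close> and \<open>w\<close>, so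
  two nearby mixed derivatives taken in opposite orders agree.\<close>

lemma second_difference_mean_value:
  fixes f :: "'a::real_normed_vector \<Rightarrow> real"
  assumes d1: "\<And>y. y \<in> U \<Longrightarrow> f differentiable (at y)"
    and d2: "\<And>y v. y \<in> U \<Longrightarrow> (\<lambda>z. frechet_derivative f (at z) v) differentiable (at y)"
    and t: "0 < t" and U: "cball x (t * (norm u + norm w)) \<subseteq> U"
  shows "\<exists>p. dist p x \<le> t * (norm u + norm w) \<and>
    f (x + t *\<^sub>R u + t *\<^sub>R w) - f (x + t *\<^sub>R u) - f (x + t *\<^sub>R w) + f x
      = t * (t * frechet_derivative (\<lambda>z. frechet_derivative f (at z) u) (at p) w)"
proof -
  have line: "((\<lambda>s. h (q + s *\<^sub>R v)) has_real_derivative frechet_derivative h (at (q + s *\<^sub>R v)) v) (at s)"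
    if "h differentiable (at (q + s *\<^sub>R v))" for h :: "'a \<Rightarrow> real" and q v s
  proof -
    have h: "(h has_derivative frechet_derivative h (at (q + s *\<^sub>R v))) (at (q + s *\<^sub>R v))"
      using that frechet_derivative_works by blast
    have "((\<lambda>s. q + s *\<^sub>R v) has_derivative (\<lambda>r. r *\<^sub>R v)) (at s)"
      by (auto intro!: derivative_eq_intros)
    from has_derivative_compose[OF this h]
    have "((\<lambda>s. h (q + s *\<^sub>R v)) has_derivative
        (\<lambda>r. frechet_derivative h (at (q + s *\<^sub>R v)) (r *\<^sub>R v))) (at s)" .
    moreover have "frechet_derivative h (at (q + s *\<^sub>R v)) (r *\<^sub>R v)
        = frechet_derivative h (at (q + s *\<^sub>R v)) v * r" for r
      using linear_scale[OF linear_frechet_derivative[OF that]] by simp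
    ultimately show ?thesis by (simp add: has_field_derivative_def)
  qed
  have near: "x + s *\<^sub>R u + r *\<^sub>R w \<in> U" "dist (x + s *\<^sub>R u + r *\<^sub>R w) x \<le> t * (norm u + norm w)"
    if "0 \<le> s" "s \<le> t" "0 \<le> r" "r \<le> t" for s r
  proof -
    have "norm (s *\<^sub>R u + r *\<^sub>R w) \<le> s * norm u + r * norm w"
      using norm_triangle_ineq[of "s *\<^sub>R u" "r *\<^sub>R w"] that by simp
    also have "\<dots> \<le> t * norm u + t * norm w"
      using that by (intro add_mono mult_right_mono) auto
    finally show *: "dist (x + s *\<^sub>R u + r *\<^sub>R w) x \<le> t * (norm u + norm w)"
      by (simp add: dist_norm algebra_simps)
    show "x + s *\<^sub>R u + r *\<^sub>R w \<in> U"
      using U * by (auto simp: dist_commute mem_cball)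
  qed
  let ?D = "\<lambda>z. frechet_derivative f (at z) u"
  \<comment> \<open>The increment in direction \<open>w\<close> as a function of the step in
    direction \<open>u\<close>; its own increment over \<open>t\<close> is the second
    difference.\<close>
  define \<phi> where "\<phi> s = f ((x + t *\<^sub>R w) + s *\<^sub>R u) - f (x + s *\<^sub>R u)" for s
  have "\<exists>s>0. s < t \<and> \<phi> t - \<phi> 0 = (t - 0) * (?D ((x + t *\<^sub>R w) + s *\<^sub>R u) - ?D (x + s *\<^sub>R u))"
  proof (rule MVT2)
    fix s assume s: "0 \<le> s" "s \<le> t"
    have "(x + t *\<^sub>R w) + s *\<^sub>R u \<in> U" "x + s *\<^sub>R u \<in> U"
      using near(1)[of s t] near(1)[of s 0] s t by (auto simp: algebra_simps)
    then show "(\<phi> has_real_derivative (?D ((x + t *\<^sub>R w) + s *\<^sub>R u) - ?D (x + s *\<^sub>R u))) (at s)"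
      unfolding \<phi>_def by (intro DERIV_diff line d1)
  qed (use t in auto)
  then obtain s where s: "0 < s" "s < t"
    and eq1: "\<phi> t - \<phi> 0 = t * (?D ((x + t *\<^sub>R w) + s *\<^sub>R u) - ?D (x + s *\<^sub>R u))" by auto
  have "\<exists>r>0. r < t \<and> ?D ((x + s *\<^sub>R u) + t *\<^sub>R w) - ?D ((x + s *\<^sub>R u) + 0 *\<^sub>R w)
      = (t - 0) * frechet_derivative ?D (at ((x + s *\<^sub>R u) + r *\<^sub>R w)) w"
    by (rule MVT2) (use t s near(1)[of s] in \<open>auto intro!: line d2\<close>)
  then obtain r where r: "0 < r" "r < t" and eq2: "?D ((x + s *\<^sub>R u) + t *\<^sub>R w) - ?D (x + s *\<^sub>R u)
      = t * frechet_derivative ?D (at ((x + s *\<^sub>R u) + r *\<^sub>R w)) w" by auto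
  have "f (x + t *\<^sub>R u + t *\<^sub>R w) - f (x + t *\<^sub>R u) - f (x + t *\<^sub>R w) + f x = \<phi> t - \<phi> 0"
    by (simp add: \<phi>_def algebra_simps)
  also have "\<dots> = t * (t * frechet_derivative ?D (at (x + s *\<^sub>R u + r *\<^sub>R w)) w)"
    using eq1 eq2 by (simp add: algebra_simps)
  finally show ?thesis using near(2)[of s r] s r by auto
qed

lemma second_derivative_symmetric_real:
  fixes f :: "'a::real_normed_vector \<Rightarrow> real"
  assumes U: "open U" "x \<in> U" and d1: "\<And>y. y \<in> U \<Longrightarrow> f differentiable (at y)"
    and d2: "\<And>y v. y \<in> U \<Longrightarrow> (\<lambda>z. frechet_derivative f (at z) v) differentiable (at y)"
    and cont: "\<And>v w. continuous_on U
      (\<lambda>y. frechet_derivative (\<lambda>z. frechet_derivative f (at z) v) (at y) w)"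
  shows "frechet_derivative (\<lambda>z. frechet_derivative f (at z) u) (at x) w
    = frechet_derivative (\<lambda>z. frechet_derivative f (at z) w) (at x) u"
proof -
  let ?H = "\<lambda>v w y. frechet_derivative (\<lambda>z. frechet_derivative f (at z) v) (at y) w"
  have H: "isCont (?H v w) x" for v w
    using cont U by (simp add: continuous_on_eq_continuous_at)
  have "\<bar>?H u w x - ?H w u x\<bar> \<le> e" if e: "e > 0" for e
  proof -
    have "\<exists>d>0. \<forall>y. dist y x < d \<longrightarrow> dist (?H u w y) (?H u w x) < e/2"
      using H[of u w] half_gt_zero[OF e] unfolding continuous_at_eps_delta by blast
    then obtain d1 where d1': "d1 > 0" "\<And>y. dist y x < d1 \<Longrightarrow> dist (?H u w y) (?H u w x) < e/2" by blast
    have "\<exists>d>0. \<forall>y. dist y x < d \<longrightarrow> dist (?H w u y) (?H w u x) < e/2"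
      using H[of w u] half_gt_zero[OF e] unfolding continuous_at_eps_delta by blast
    then obtain d2 where d2': "d2 > 0" "\<And>y. dist y x < d2 \<Longrightarrow> dist (?H w u y) (?H w u x) < e/2" by blast
    obtain d3 where d3: "d3 > 0" "ball x d3 \<subseteq> U" using U open_contains_ball by blast
    define d where "d = min d1 (min d2 d3)"
    have d: "d > 0" using d1' d2' d3 by (simp add: d_def)
    \<comment> \<open>The summand \<open>1\<close> covers \<open>u = w = 0\<close> and makes the
      bound \<open>td\<close> strict.\<close>
    define t where "t = d / (norm u + norm w + 1)"
    have n: "norm u + norm w + 1 > 0" by (simp add: add_nonneg_pos)
    have t: "t > 0" using d n by (simp add: t_def)
    have td: "t * (norm u + norm w) < d" 
      using d n by (simp add: t_def field_simps)
    have sub: "cball x (t * (norm u + norm w)) \<subseteq> U"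
      using td d3(2) by (force simp: d_def)
    have sub': "cball x (t * (norm w + norm u)) \<subseteq> U"
      using sub by (simp add: add.commute)
    obtain p where p: "dist p x \<le> t * (norm u + norm w)"
      "f (x + t *\<^sub>R u + t *\<^sub>R w) - f (x + t *\<^sub>R u) - f (x + t *\<^sub>R w) + f x = t * (t * ?H u w p)"
      using second_difference_mean_value[OF d1 d2 t sub] by blast
    obtain q where q: "dist q x \<le> t * (norm w + norm u)"
      "f (x + t *\<^sub>R w + t *\<^sub>R u) - f (x + t *\<^sub>R w) - f (x + t *\<^sub>R u) + f x = t * (t * ?H w u q)"
      using second_difference_mean_value[OF d1 d2 t sub'] by blast
    have "t * (t * ?H u w p) = t * (t * ?H w u q)"
      using p(2) q(2) by (simp add: algebra_simps)
    then have "?H u w p = ?H w u q" using t by simp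
    moreover have "dist (?H u w p) (?H u w x) < e/2"
      using p(1) td by (intro d1'(2)) (simp add: d_def)
    moreover have "dist (?H w u q) (?H w u x) < e/2"
      using q(1) td by (intro d2'(2)) (simp add: d_def add.commute)
    ultimately show ?thesis unfolding dist_real_def by linarith
  qed
  then have "\<bar>?H u w x - ?H w u x\<bar> \<le> 0" by (rule field_le_epsilon) simp
  then show ?thesis by simp
qed

lemma second_derivative_symmetric:
  fixes f :: "'a::real_normed_vector \<Rightarrow> 'b::euclidean_space"
  assumes U: "open U" "x \<in> U" and sm: "smooth_map_on f U"
  shows "frechet_derivative (\<lambda>z. frechet_derivative f (at z) u) (at x) w
    = frechet_derivative (\<lambda>z. frechet_derivative f (at z) w) (at x) u"
proof (rule euclidean_eqI)
  fix b :: 'b assume "b \<in> Basis"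
  have D: "frechet_derivative (\<lambda>z. h z \<bullet> b) (at y) = (\<lambda>v. frechet_derivative h (at y) v \<bullet> b)"
    "(\<lambda>z. h z \<bullet> b) differentiable (at y)"
    if "h differentiable (at y)" for h :: "'a \<Rightarrow> 'b" and y
  proof -
    have "(h has_derivative frechet_derivative h (at y)) (at y)"
      using that frechet_derivative_works by blast
    then have "((\<lambda>z. h z \<bullet> b) has_derivative (\<lambda>v. frechet_derivative h (at y) v \<bullet> b)) (at y)"
      by (rule has_derivative_inner_left)
    then show "frechet_derivative (\<lambda>z. h z \<bullet> b) (at y) = (\<lambda>v. frechet_derivative h (at y) v \<bullet> b)"
      "(\<lambda>z. h z \<bullet> b) differentiable (at y)"
      by (auto intro: frechet_derivative_eqI differentiableI)
  qed
  have d1: "f differentiable (at y)" if "y \<in> U" for y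
    using sm that by (rule smooth_map_on_differentiable)
  have d2: "(\<lambda>z. frechet_derivative f (at z) v) differentiable (at y)" if "y \<in> U" for y v
    using sm that by (intro smooth_map_on_differentiable[OF smooth_map_on_frechet_derivative])
  let ?f = "\<lambda>z. f z \<bullet> b"
  have e1: "frechet_derivative ?f (at y) v = frechet_derivative f (at y) v \<bullet> b" if "y \<in> U" for y v
    using D(1)[OF d1[OF that]] by simp
  have e2: "frechet_derivative (\<lambda>z. frechet_derivative ?f (at z) v) (at y) w
      = frechet_derivative (\<lambda>z. frechet_derivative f (at z) v) (at y) w \<bullet> b" if "y \<in> U" for y v w
    using frechet_derivative_cong_open[OF U(1) that e1] D(1)[OF d2[OF that]] by simp
  have "frechet_derivative (\<lambda>z. frechet_derivative ?f (at z) u) (at x) w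
      = frechet_derivative (\<lambda>z. frechet_derivative ?f (at z) w) (at x) u"
  proof (rule second_derivative_symmetric_real[OF U])
    fix y v assume y: "y \<in> U"
    show "?f differentiable (at y)" by (rule D(2)[OF d1[OF y]])
    show "(\<lambda>z. frechet_derivative ?f (at z) v) differentiable (at y)"
      by (rule differentiable_cong_open[OF U(1) y _ D(2)[OF d2[OF y]]]) (simp add: e1)
  next
    fix v w
    have "continuous_on U (\<lambda>y. frechet_derivative (\<lambda>z. frechet_derivative f (at z) v) (at y) w \<bullet> b)"
      by (intro continuous_intros smooth_map_on_continuous smooth_map_on_frechet_derivative sm)
    then show "continuous_on U (\<lambda>y. frechet_derivative (\<lambda>z. frechet_derivative ?f (at z) v) (at y) w)"
      by (rule continuous_on_cong[THEN iffD1, rotated 2]) (simp_all add: e2)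
  qed
  then show "frechet_derivative (\<lambda>z. frechet_derivative f (at z) u) (at x) w \<bullet> b
    = frechet_derivative (\<lambda>z. frechet_derivative f (at z) w) (at x) u \<bullet> b"
    using e2[OF U(2)] by simp
qed

text \<open>Product rule for a linear map depending on a point. Expanding the argument in a finite
  basis leaves a finite sum of products, so differentiability of \<open>L y v\<close> for each fixed
  \<open>v\<close> is enough. It is used for tensors with one slot filled by J or by a Christoffel
  term.\<close>

lemma has_derivative_linear_family:
  fixes L :: "'a::real_normed_vector \<Rightarrow> 'v::euclidean_space \<Rightarrow> 'b::real_normed_vector"
  assumes U: "open U" "x \<in> U" and lin: "\<And>y. y \<in> U \<Longrightarrow> linear (L y)"
    and diff: "\<And>v. (\<lambda>y. L y v) differentiable (at x)"
    and f: "(f has_derivative f') (at x)"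
  shows "((\<lambda>y. L y (f y)) has_derivative
    (\<lambda>w. frechet_derivative (\<lambda>y. L y (f x)) (at x) w + L x (f' w))) (at x)"
proof -
  have expand: "L y v = (\<Sum>b\<in>Basis. (v \<bullet> b) *\<^sub>R L y b)" if "y \<in> U" for y v
    using linear_sum[OF lin[OF that], of "\<lambda>b. (v \<bullet> b) *\<^sub>R b" Basis]
    by (simp add: euclidean_representation linear_scale[OF lin[OF that]])
  let ?D = "\<lambda>v. frechet_derivative (\<lambda>y. L y v) (at x)"
  have D: "((\<lambda>y. L y v) has_derivative ?D v) (at x)" for v
    using diff frechet_derivative_works by blast
  have "((\<lambda>y. \<Sum>b\<in>Basis. (f x \<bullet> b) *\<^sub>R L y b) has_derivative (\<lambda>w. \<Sum>b\<in>Basis. (f x \<bullet> b) *\<^sub>R ?D b w)) (at x)"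
    by (intro has_derivative_sum has_derivative_scaleR_right D)
  then have "((\<lambda>y. L y (f x)) has_derivative (\<lambda>w. \<Sum>b\<in>Basis. (f x \<bullet> b) *\<^sub>R ?D b w)) (at x)"
    by (rule has_derivative_transform_within_open[OF _ U]) (simp add: expand[symmetric])
  then have D': "?D (f x) = (\<lambda>w. \<Sum>b\<in>Basis. (f x \<bullet> b) *\<^sub>R ?D b w)"
    by (rule frechet_derivative_eqI)
  have "((\<lambda>y. \<Sum>b\<in>Basis. (f y \<bullet> b) *\<^sub>R L y b) has_derivative
      (\<lambda>w. \<Sum>b\<in>Basis. (f x \<bullet> b) *\<^sub>R ?D b w + (f' w \<bullet> b) *\<^sub>R L x b)) (at x)"
    by (intro has_derivative_sum has_derivative_scaleR has_derivative_inner_left f D)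
  moreover have "(\<lambda>w. \<Sum>b\<in>Basis. (f x \<bullet> b) *\<^sub>R ?D b w + (f' w \<bullet> b) *\<^sub>R L x b)
      = (\<lambda>w. ?D (f x) w + L x (f' w))"
    by (simp add: D' expand[OF U(2), of "f' _"] sum.distrib)
  ultimately have "((\<lambda>y. \<Sum>b\<in>Basis. (f y \<bullet> b) *\<^sub>R L y b) has_derivative
      (\<lambda>w. ?D (f x) w + L x (f' w))) (at x)" by simp
  then show ?thesis
    by (rule has_derivative_transform_within_open[OF _ U]) (simp add: expand[symmetric])
qed

lemma frechet_derivative_linear_family:
  fixes L :: "'a::real_normed_vector \<Rightarrow> 'v::real_vector \<Rightarrow> 'b::real_normed_vector"
  assumes U: "open U" "x \<in> U" and lin: "\<And>y. y \<in> U \<Longrightarrow> linear (L y)"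
    and diff: "\<And>v. (\<lambda>y. L y v) differentiable (at x)"
  shows "linear (\<lambda>v. frechet_derivative (\<lambda>y. L y v) (at x) u)"
proof (rule linearI)
  have D: "((\<lambda>y. L y v) has_derivative frechet_derivative (\<lambda>y. L y v) (at x)) (at x)" for v
    using diff frechet_derivative_works by blast
  show "frechet_derivative (\<lambda>y. L y (v + w)) (at x) u =
    frechet_derivative (\<lambda>y. L y v) (at x) u + frechet_derivative (\<lambda>y. L y w) (at x) u" for v w
    using frechet_derivative_cong_open[OF U, of "\<lambda>y. L y (v + w)" "\<lambda>y. L y v + L y w"]
      frechet_derivative_eqI[OF has_derivative_add[OF D[of v] D[of w]]]
    by (simp add: linear_add[OF lin])
  show "frechet_derivative (\<lambda>y. L y (r *\<^sub>R v)) (at x) u = r *\<^sub>R frechet_derivative (\<lambda>y. L y v) (at x) u" for r v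
    using frechet_derivative_cong_open[OF U, of "\<lambda>y. L y (r *\<^sub>R v)" "\<lambda>y. r *\<^sub>R L y v"]
      frechet_derivative_eqI[OF has_derivative_scaleR_right[OF D[of v]], of r]
    by (simp add: linear_scale[OF lin])
qed

lemma multilinear_form_1: "multilinear_form 1 T \<Longrightarrow> linear (\<lambda>u. T [u])"
  unfolding multilinear_form_def by (drule spec[where x = "[0]"]) simp

lemma multilinear_form_2:
  assumes "multilinear_form 2 T"
  shows "linear (\<lambda>u. T [u, v])" "linear (\<lambda>v. T [u, v])"
  using assms[unfolded multilinear_form_def, rule_format, of "[0, v]" 0]
    assms[unfolded multilinear_form_def, rule_format, of "[u, 0]" 1] by simp_all

section \<open>Differentiability of the determinant and of the inverse matrix\<close>

lemma det_differentiable: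
  fixes M :: "'a::real_normed_vector \<Rightarrow> real^'n^'n"
  assumes "\<And>i j. (\<lambda>y. M y $ i $ j) differentiable (at x)"
  shows "(\<lambda>y. det (M y)) differentiable (at x)"
proof -
  have "(\<lambda>y. \<Prod>i\<in>I. M y $ i $ p i) differentiable (at x)" if "finite I" for I and p :: "'n \<Rightarrow> 'n"
    using that by induction (auto intro!: differentiable_mult assms)
  then show ?thesis unfolding det_def by (intro differentiable_sum differentiable_mult) auto
qed

lemma matrix_inv_inverse:
  fixes M :: "real^'n^'n"
  assumes "invertible M"
  shows "M ** matrix_inv M = mat 1" "matrix_inv M ** M = mat 1"
  using someI_ex[OF assms[unfolded invertible_def]] unfolding matrix_inv_def by blast+

text \<open>Cramer's rule for the columns of the inverse; quotients of determinants are visibly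
  differentiable in the entries of \<open>M\<close>.\<close>

lemma matrix_inv_entry:
  fixes M :: "real^'n^'n"
  assumes "invertible M"
  shows "matrix_inv M $ k $ m = det (\<chi> i j. if j = k then axis m 1 $ i else M $ i $ j) / det M"
proof -
  have "M *v column m (matrix_inv M) = column m (M ** matrix_inv M)"
    by (simp add: matrix_vector_mult_def column_def matrix_matrix_mult_def vec_eq_iff)
  also have "\<dots> = axis m 1"
    by (simp add: matrix_inv_inverse[OF assms] column_def mat_def axis_def vec_eq_iff)
  finally have "column m (matrix_inv M) = (\<chi> k. det (\<chi> i j. if j = k then axis m 1 $ i else M $ i $ j) / det M)"
    using cramer[of M] assms invertible_det_nz by blast
  then show ?thesis by (simp add: column_def vec_eq_iff)
qed

lemma matrix_inv_differentiable:
  fixes M :: "'a::real_normed_vector \<Rightarrow> real^'n^'n"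
  assumes U: "open U" "x \<in> U" and inv: "\<And>y. y \<in> U \<Longrightarrow> invertible (M y)"
    and diff: "\<And>i j. (\<lambda>y. M y $ i $ j) differentiable (at x)"
  shows "(\<lambda>y. matrix_inv (M y) $ k $ m) differentiable (at x)"
proof (rule differentiable_cong_open[OF U])
  show "(\<lambda>y. det (\<chi> i j. if j = k then axis m 1 $ i else M y $ i $ j) / det (M y)) differentiable (at x)"
  proof (rule differentiable_divide)
    show "(\<lambda>y. det (\<chi> i j. if j = k then axis m 1 $ i else M y $ i $ j)) differentiable (at x)"
    proof (rule det_differentiable)
      fix i j
      show "(\<lambda>y. (\<chi> i j. if j = k then axis m 1 $ i else M y $ i $ j) $ i $ j) differentiable (at x)"
        by (cases "j = k") (simp_all add: diff)
    qed
    show "(\<lambda>y. det (M y)) differentiable (at x)" by (rule det_differentiable[OF diff])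
    show "det (M x) \<noteq> 0" using inv[OF U(2)] invertible_det_nz by blast
  qed
qed (simp add: matrix_inv_entry inv)

lemma linear_eq_axis:
  fixes f h :: "real^'n \<Rightarrow> 'b::real_vector"
  assumes "linear f" "linear h" "\<And>i. f (axis i 1) = h (axis i 1)"
  shows "f v = h v"
proof -
  have "f = h"
    by (rule linear_eq_stdbasis[OF assms(1,2)]) (auto simp: Basis_vec_def assms(3))
  then show ?thesis by simp
qed

lemma vec_differentiable:
  fixes f :: "'a::real_normed_vector \<Rightarrow> real^'n"
  assumes "\<And>i. (\<lambda>y. f y $ i) differentiable (at x)"
  shows "f differentiable (at x)"
proof -
  have "(f has_derivative (\<lambda>u. \<chi> i. frechet_derivative (\<lambda>y. f y $ i) (at x) u)) (at x)"
    unfolding has_derivative_componentwise_within[of f]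
    using assms unfolding frechet_derivative_works by (auto simp: Basis_vec_def inner_axis)
  then show ?thesis by (rule differentiableI)
qed

lemma frechet_derivative_component:
  fixes f :: "'a::real_normed_vector \<Rightarrow> real^'n"
  assumes "f differentiable (at x)"
  shows "frechet_derivative (\<lambda>y. f y $ i) (at x) u = frechet_derivative f (at x) u $ i"
proof -
  have "(f has_derivative frechet_derivative f (at x)) (at x)"
    using assms frechet_derivative_works by blast
  then have "((\<lambda>y. f y $ i) has_derivative (\<lambda>u. frechet_derivative f (at x) u $ i)) (at x)"
    by (rule bounded_linear.has_derivative[OF bounded_linear_vec_nth])
  then show ?thesis by (simp add: frechet_derivative_eqI)
qed

section \<open>Levi-Civita connection and curvature\<close>

lemma christoffel_map_linear:
  "linear (\<lambda>u. christoffel_map g c x u v)" "linear (\<lambda>v. christoffel_map g c x u v)"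
  unfolding christoffel_map_def
  by (rule linearI; simp add: vec_eq_iff algebra_simps sum.distrib sum_distrib_left)+

lemma christoffel_map_axis_left:
  "christoffel_map g c x (axis i 1) v $ k = (\<Sum>j\<in>UNIV. christoffel g c x k i j * v $ j)"
  by (simp add: christoffel_map_def axis_def if_distrib if_distribR sum.If_cases sum_distrib_left
      flip: sum_distrib_left cong: if_cong)

lemma christoffel_map_axis:
  "christoffel_map g c x (axis i 1) (axis j 1) $ k = christoffel g c x k i j"
  unfolding christoffel_map_axis_left by (simp add: axis_def if_distrib cong: if_cong)

text \<open>The commutator of covariant derivatives along vector fields constant in the chart; their
  Lie brackets vanish, hence no bracket term.\<close>

definition curvature ::
    "('a, 'n::finite, real) tensor \<Rightarrow> ('a, 'n) chart \<Rightarrow> real^'n \<Rightarrow> real^'n \<Rightarrow> real^'n \<Rightarrow> real^'n \<Rightarrow> real^'n" where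
  "curvature g c x u v w =
     frechet_derivative (\<lambda>y. christoffel_map g c y v w) (at x) u
     - frechet_derivative (\<lambda>y. christoffel_map g c y u w) (at x) v
     + christoffel_map g c x u (christoffel_map g c x v w)
     - christoffel_map g c x v (christoffel_map g c x u w)"

locale riemannian_chart =
  fixes g :: "('a, 'n::finite, real) tensor" and c :: "('a, 'n) chart" and U :: "(real^'n) set"
  assumes open_U: "open U"
    and metric_multilinear: "x \<in> U \<Longrightarrow> multilinear_form 2 (g c x)"
    and metric_smooth: "length vs = 2 \<Longrightarrow> smooth_map_on (\<lambda>x. g c x vs) U"
    and metric_sym: "x \<in> U \<Longrightarrow> g c x [u, v] = g c x [v, u]"
    and metric_pos: "x \<in> U \<Longrightarrow> v \<noteq> 0 \<Longrightarrow> 0 < g c x [v, v]"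
begin

abbreviation \<Gamma> where "\<Gamma> \<equiv> christoffel_map g c"

lemma metric_linear:
  assumes "x \<in> U"
  shows "linear (\<lambda>u. g c x [u, v])" "linear (\<lambda>v. g c x [u, v])"
  using multilinear_form_2[OF metric_multilinear[OF assms]] by auto

lemma metric_diff: "x \<in> U \<Longrightarrow> (\<lambda>y. g c y [u, v]) differentiable (at x)"
  by (intro smooth_map_on_differentiable[OF metric_smooth]) simp

lemma metric_gram:
  assumes "x \<in> U"
  shows "g c x [u, axis l 1] = (\<Sum>k\<in>UNIV. u $ k * gram g c x $ k $ l)"
proof -
  have "g c x [u, axis l 1] = g c x [\<Sum>k\<in>UNIV. u $ k *\<^sub>R axis k 1, axis l 1]"
    using basis_expansion[of u] by (simp add: scalar_mult_eq_scaleR)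
  also have "\<dots> = (\<Sum>k\<in>UNIV. u $ k * gram g c x $ k $ l)"
    by (simp add: linear_sum[OF metric_linear(1)[OF assms]] linear_scale[OF metric_linear(1)[OF assms]] gram_def)
  finally show ?thesis .
qed

lemma gram_sym: "x \<in> U \<Longrightarrow> gram g c x $ i $ j = gram g c x $ j $ i"
  by (simp add: gram_def metric_sym)

lemma gram_diff: "x \<in> U \<Longrightarrow> (\<lambda>y. gram g c y $ i $ j) differentiable (at x)"
  by (simp add: gram_def metric_diff)

text \<open>A vector in the kernel is orthogonal to all basis vectors, hence to itself.\<close>

lemma gram_invertible:
  assumes x: "x \<in> U"
  shows "invertible (gram g c x)"
proof -
  have "w = 0" if "gram g c x *v w = 0" for w
  proof (rule ccontr)
    assume "w \<noteq> 0"
    have "g c x [axis l 1, w] = 0" for l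
    proof -
      have "g c x [axis l 1, w] = (\<Sum>k\<in>UNIV. w $ k * gram g c x $ k $ l)"
        using metric_sym[OF x, of "axis l 1" w] metric_gram[OF x] by simp
      also have "\<dots> = (gram g c x *v w) $ l"
        unfolding matrix_vector_mult_def by (simp add: gram_sym[OF x, of _ l] mult.commute)
      finally show ?thesis using that by simp
    qed
    then have "g c x [w, w] = 0"
      using linear_eq_axis[OF metric_linear(1)[OF x] linear_zero, of w w] by simp
    then show False using metric_pos[OF x \<open>w \<noteq> 0\<close>] by simp
  qed
  then show ?thesis
    using matrix_left_invertible_ker[of "gram g c x"] invertible_left_inverse by blast
qed

lemma christoffel_diff:
  assumes x: "x \<in> U"
  shows "(\<lambda>y. christoffel g c y k i j) differentiable (at x)"
proof -
  have "(\<lambda>y. partial_deriv m (\<lambda>z. gram g c z $ i $ j) y) differentiable (at x)" for m i j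
    unfolding partial_deriv_def gram_def
    using smooth_map_on_differentiable[OF smooth_map_on_frechet_derivative[OF metric_smooth] x] by simp
  then show ?thesis
    unfolding christoffel_def
    by (intro differentiable_mult differentiable_sum ballI differentiable_add differentiable_diff
        matrix_inv_differentiable[OF open_U x] gram_invertible gram_diff x) auto
qed

lemma christoffel_map_diff:
  assumes x: "x \<in> U"
  shows "(\<lambda>y. \<Gamma> y u v) differentiable (at x)"
  by (rule vec_differentiable) (simp add: christoffel_map_def, intro differentiable_mult differentiable_sum ballI
        christoffel_diff x; simp)

lemma partial_gram_sym:
  assumes "x \<in> U"
  shows "partial_deriv m (\<lambda>y. gram g c y $ i $ j) x = partial_deriv m (\<lambda>y. gram g c y $ j $ i) x"
  unfolding partial_deriv_def
  using frechet_derivative_cong_open[OF open_U assms, of "\<lambda>y. gram g c y $ i $ j" "\<lambda>y. gram g c y $ j $ i"]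
    gram_sym by simp

lemma christoffel_sym: "x \<in> U \<Longrightarrow> christoffel g c x k i j = christoffel g c x k j i"
  unfolding christoffel_def using partial_gram_sym[of x _ i j] by (simp add: add.commute)

lemma christoffel_map_sym:
  assumes "x \<in> U"
  shows "\<Gamma> x u v = \<Gamma> x v u"
  unfolding christoffel_map_def vec_eq_iff vec_lambda_beta
  by (subst sum.swap) (simp add: christoffel_sym[OF assms, of _ _ _] mult.commute mult.left_commute)

text \<open>Lowering the index cancels the inverse Gram matrix and leaves the Christoffel symbol of
  the first kind.\<close>

lemma christoffel_lower:
  assumes x: "x \<in> U"
  shows "g c x [\<Gamma> x (axis i 1) (axis j 1), axis l 1] =
    (partial_deriv i (\<lambda>y. gram g c y $ j $ l) x + partial_deriv j (\<lambda>y. gram g c y $ i $ l) x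
      - partial_deriv l (\<lambda>y. gram g c y $ i $ j) x) / 2"
proof -
  define h where "h m = partial_deriv i (\<lambda>y. gram g c y $ j $ m) x + partial_deriv j (\<lambda>y. gram g c y $ i $ m) x
      - partial_deriv m (\<lambda>y. gram g c y $ i $ j) x" for m
  let ?M = "gram g c x"
  have "g c x [\<Gamma> x (axis i 1) (axis j 1), axis l 1] = (\<Sum>k\<in>UNIV. (1/2) * (\<Sum>m\<in>UNIV. matrix_inv ?M $ k $ m * h m) * ?M $ l $ k)"
    by (simp add: metric_gram[OF x] christoffel_map_axis christoffel_def h_def gram_sym[OF x, of _ l])
  also have "\<dots> = (1/2) * (\<Sum>m\<in>UNIV. (?M ** matrix_inv ?M) $ l $ m * h m)"
    unfolding matrix_matrix_mult_def
    by (simp add: sum_distrib_left sum_distrib_right) (subst sum.swap, simp add: mult_ac)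
  also have "\<dots> = h l / 2"
    by (simp add: matrix_inv_inverse[OF gram_invertible[OF x]] mat_def if_distrib if_distribR cong: if_cong)
  finally show ?thesis by (simp add: h_def)
qed

text \<open>On basis vectors the two first-kind symbols add up to the derivative of one Gram entry.
  Both sides are linear in \<open>u\<close>, \<open>v\<close> and \<open>w\<close>, so the identity
  extends one slot at a time.\<close>

lemma metric_compatible:
  assumes x: "x \<in> U"
  shows "frechet_derivative (\<lambda>y. g c y [v, w]) (at x) u = g c x [\<Gamma> x u v, w] + g c x [v, \<Gamma> x u w]"
proof -
  note lin = metric_linear[OF x] christoffel_map_linear
  note comp = linear_compose[OF christoffel_map_linear(1) metric_linear(1)[OF x], unfolded o_def]
    linear_compose[OF christoffel_map_linear(1) metric_linear(2)[OF x], unfolded o_def]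
    linear_compose[OF christoffel_map_linear(2) metric_linear(1)[OF x], unfolded o_def]
    linear_compose[OF christoffel_map_linear(2) metric_linear(2)[OF x], unfolded o_def]
  have basis: "frechet_derivative (\<lambda>y. g c y [axis j 1, axis l 1]) (at x) (axis i 1)
    = g c x [\<Gamma> x (axis i 1) (axis j 1), axis l 1] + g c x [axis j 1, \<Gamma> x (axis i 1) (axis l 1)]" for i j l
    using partial_gram_sym[OF x]
    by (simp add: metric_sym[OF x, of "axis j 1"] christoffel_lower[OF x] partial_deriv_def gram_def field_simps)
  have 1: "frechet_derivative (\<lambda>y. g c y [axis j 1, axis l 1]) (at x) u
    = g c x [\<Gamma> x u (axis j 1), axis l 1] + g c x [axis j 1, \<Gamma> x u (axis l 1)]" for j l
    by (rule linear_eq_axis[where v = u])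
      (auto intro!: linear_frechet_derivative metric_diff x linear_compose_add comp basis)
  have 2: "frechet_derivative (\<lambda>y. g c y [v, axis l 1]) (at x) u
    = g c x [\<Gamma> x u v, axis l 1] + g c x [v, \<Gamma> x u (axis l 1)]" for l
    by (rule linear_eq_axis[where v = v])
      (auto intro!: frechet_derivative_linear_family[OF open_U x] metric_linear metric_diff x
        linear_compose_add comp 1)
  show ?thesis
    by (rule linear_eq_axis[where v = w])
      (auto intro!: frechet_derivative_linear_family[OF open_U x] metric_linear metric_diff x
        linear_compose_add comp 2)
qed

lemma curvature_linear:
  assumes x: "x \<in> U"
  shows "linear (\<lambda>u. curvature g c x u v w)" "linear (\<lambda>w. curvature g c x u v w)"
  unfolding curvature_def
  using christoffel_map_linear[of g c]
    linear_compose[OF christoffel_map_linear(2) christoffel_map_linear(2), unfolded o_def]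
    linear_compose[OF christoffel_map_linear(1) christoffel_map_linear(2), unfolded o_def]
  by (intro linear_compose_add linear_compose_sub linear_frechet_derivative christoffel_map_diff x
      frechet_derivative_linear_family[OF open_U x]; blast)+

lemma curvature_antisym: "curvature g c x u v w = - curvature g c x v u w"
  by (simp add: curvature_def)

lemma curvature_bianchi:
  assumes x: "x \<in> U"
  shows "curvature g c x u v w + curvature g c x v w u + curvature g c x w u v = 0"
proof -
  have D: "frechet_derivative (\<lambda>y. \<Gamma> y a b) (at x) = frechet_derivative (\<lambda>y. \<Gamma> y b a) (at x)" for a b
    by (rule frechet_derivative_cong_open[OF open_U x christoffel_map_sym])
  show ?thesis
    unfolding curvature_def D[of u v] D[of v w] D[of w u] christoffel_map_sym[OF x, of u v]
      christoffel_map_sym[OF x, of v w] christoffel_map_sym[OF x, of w u]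
    by simp
qed

lemma ricci_eq_trace:
  assumes x: "x \<in> U"
  shows "ricci g c x j k = (\<Sum>i\<in>UNIV. curvature g c x (axis i 1) (axis j 1) (axis k 1) $ i)"
proof -
  have "frechet_derivative (\<lambda>y. \<Gamma> y (axis a 1) (axis b 1)) (at x) u $ i
      = frechet_derivative (\<lambda>y. christoffel g c y i a b) (at x) u" for a b u i
    using frechet_derivative_component[OF christoffel_map_diff[OF x], of "axis a 1" "axis b 1" i u]
    unfolding christoffel_map_axis by simp
  then show ?thesis
    by (simp add: ricci_def curvature_def partial_deriv_def christoffel_map_axis
        christoffel_map_axis_left[where v = "christoffel_map _ _ _ _ _"] sum.distrib sum_subtractf)
qed

text \<open>The Ricci identity. For a parallel tensor every derivative is a sum of Christoffel
  insertions; differentiating once more and exchanging the two directions leaves only pairs of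
  insertions in the same slot, whose commutator is the curvature.\<close>

lemma parallel_curvature:
  fixes T :: "('a, 'n, 'b::euclidean_space) tensor"
  assumes multilin: "\<And>x. x \<in> U \<Longrightarrow> multilinear_form k (T c x)"
    and smooth: "\<And>vs. length vs = k \<Longrightarrow> smooth_map_on (\<lambda>x. T c x vs) U"
    and parallel: "\<And>x u vs. x \<in> U \<Longrightarrow> length vs = k \<Longrightarrow> cov_deriv g T c x u vs = 0"
    and x: "x \<in> U" and vs: "length vs = k"
  shows "endo_act (curvature g c x u w) (T c x) vs = 0"
proof -
  let ?D = "\<lambda>u vs y. frechet_derivative (\<lambda>z. T c z vs) (at y) u"
  have D: "?D u vs y = (\<Sum>j<k. T c y (vs[j := \<Gamma> y u (vs ! j)]))" if "y \<in> U" "length vs = k" for u vs y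
    using parallel[OF that, of u] that by (simp add: cov_deriv_def endo_act_def)
  have lin: "linear (\<lambda>v. T c y (vs[j := v]))" if "y \<in> U" "j < k" for y j
    using multilin[OF that(1)] that vs unfolding multilinear_form_def by blast
  have diff: "(\<lambda>y. T c y vs') differentiable (at x)" if "length vs' = k" for vs'
    using smooth_map_on_differentiable[OF smooth[OF that] x] .
  let ?\<Gamma>' = "\<lambda>u j. frechet_derivative (\<lambda>y. \<Gamma> y u (vs ! j)) (at x)"
  \<comment> \<open>The terms with insertions in two different slots. They are symmetric in the
    directions because updates of different slots commute, so they drop out of the
    comparison.\<close>
  define off where "off u w = (\<Sum>j<k. \<Sum>l<k. if l = j then 0 else
      T c x (vs[j := \<Gamma> x u (vs ! j), l := \<Gamma> x w (vs ! l)]))" for u w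
  have H: "frechet_derivative (?D u vs) (at x) w
      = (\<Sum>j<k. T c x (vs[j := ?\<Gamma>' u j w + \<Gamma> x w (\<Gamma> x u (vs ! j))])) + off u w" for u w
  proof -
    have \<Gamma>': "((\<lambda>y. \<Gamma> y u (vs ! j)) has_derivative ?\<Gamma>' u j) (at x)" for j
      using christoffel_map_diff[OF x] frechet_derivative_works by blast
    have "((\<lambda>y. \<Sum>j<k. T c y (vs[j := \<Gamma> y u (vs ! j)])) has_derivative
        (\<lambda>w. \<Sum>j<k. ?D w (vs[j := \<Gamma> x u (vs ! j)]) x + T c x (vs[j := ?\<Gamma>' u j w]))) (at x)"
      by (intro has_derivative_sum has_derivative_linear_family[OF open_U x] lin diff \<Gamma>')
        (use vs in auto)
    then have "(?D u vs has_derivative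
        (\<lambda>w. \<Sum>j<k. ?D w (vs[j := \<Gamma> x u (vs ! j)]) x + T c x (vs[j := ?\<Gamma>' u j w]))) (at x)"
      by (rule has_derivative_transform_within_open[OF _ open_U x]) (simp add: D vs)
    then have "frechet_derivative (?D u vs) (at x) w =
        (\<Sum>j<k. ?D w (vs[j := \<Gamma> x u (vs ! j)]) x + T c x (vs[j := ?\<Gamma>' u j w]))"
      by (simp add: frechet_derivative_eqI)
    also have "\<dots> = (\<Sum>j<k. T c x (vs[j := ?\<Gamma>' u j w + \<Gamma> x w (\<Gamma> x u (vs ! j))]) +
       (\<Sum>l<k. if l = j then 0 else T c x (vs[j := \<Gamma> x u (vs ! j), l := \<Gamma> x w (vs ! l)])))"
    proof (rule sum.cong[OF refl])
      fix j assume "j \<in> {..<k}"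
      then have j: "j < k" by simp
      have "?D w (vs[j := \<Gamma> x u (vs ! j)]) x
        = (\<Sum>l<k. T c x (vs[j := \<Gamma> x u (vs ! j), l := \<Gamma> x w (vs[j := \<Gamma> x u (vs ! j)] ! l)]))"
        using vs by (simp add: D x)
      also have "\<dots> = (\<Sum>l<k. (if l = j then T c x (vs[j := \<Gamma> x w (\<Gamma> x u (vs ! j))]) else 0) +
          (if l = j then 0 else T c x (vs[j := \<Gamma> x u (vs ! j), l := \<Gamma> x w (vs ! l)])))"
        by (rule sum.cong) (use vs in auto)
      also have "\<dots> = T c x (vs[j := \<Gamma> x w (\<Gamma> x u (vs ! j))]) +
          (\<Sum>l<k. if l = j then 0 else T c x (vs[j := \<Gamma> x u (vs ! j), l := \<Gamma> x w (vs ! l)]))"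
        using j by (simp add: sum.distrib)
      finally show "?D w (vs[j := \<Gamma> x u (vs ! j)]) x + T c x (vs[j := ?\<Gamma>' u j w]) =
        T c x (vs[j := ?\<Gamma>' u j w + \<Gamma> x w (\<Gamma> x u (vs ! j))]) +
          (\<Sum>l<k. if l = j then 0 else T c x (vs[j := \<Gamma> x u (vs ! j), l := \<Gamma> x w (vs ! l)]))"
        using linear_add[OF lin[OF x j]] by simp
    qed
    finally show ?thesis by (simp add: sum.distrib off_def)
  qed
  have off_sym: "off u w = off w u"
    unfolding off_def
    by (subst sum.swap, intro sum.cong refl) (auto simp: list_update_swap)
  have "frechet_derivative (?D u vs) (at x) w = frechet_derivative (?D w vs) (at x) u"
    by (rule second_derivative_symmetric[OF open_U x smooth[OF vs]])
  then have eq: "(\<Sum>j<k. T c x (vs[j := ?\<Gamma>' u j w + \<Gamma> x w (\<Gamma> x u (vs ! j))]))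
    = (\<Sum>j<k. T c x (vs[j := ?\<Gamma>' w j u + \<Gamma> x u (\<Gamma> x w (vs ! j))]))"
    using off_sym by (simp add: H)
  have "endo_act (curvature g c x u w) (T c x) vs = - (\<Sum>j<k.
      T c x (vs[j := ?\<Gamma>' w j u + \<Gamma> x u (\<Gamma> x w (vs ! j))])
      - T c x (vs[j := ?\<Gamma>' u j w + \<Gamma> x w (\<Gamma> x u (vs ! j))]))"
    unfolding endo_act_def vs
  proof (intro arg_cong[where f = uminus] sum.cong refl)
    fix j assume "j \<in> {..<k}"
    then have j: "j < k" by simp
    show "T c x (vs[j := curvature g c x u w (vs ! j)]) =
      T c x (vs[j := ?\<Gamma>' w j u + \<Gamma> x u (\<Gamma> x w (vs ! j))])
      - T c x (vs[j := ?\<Gamma>' u j w + \<Gamma> x w (\<Gamma> x u (vs ! j))])"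
      unfolding curvature_def linear_diff[OF lin[OF x j], symmetric]
      by (simp add: algebra_simps)
  qed
  also have "\<dots> = 0" by (simp add: sum_subtractf eq)
  finally show ?thesis .
qed

end

section \<open>Forms of low degree\<close>

lemma wedge_1_1:
  "wedge 1 1 \<alpha> \<beta> [u, v] = \<alpha> [u] * \<beta> [v] - \<alpha> [v] * \<beta> [u]"
proof -
  have S: "{..<1 + 1} = insert 0 {1::nat}" by auto
  show ?thesis
    unfolding wedge_def S
    by (subst sum_over_permutations_insert)
      (simp_all add: permutes_sing sign_swap_id transpose_def upt_rec sign_id)
qed

lemma wedge_1_2:
  assumes "\<And>u v. \<beta> [u, v] = - \<beta> [v, u]"
  shows "wedge 1 2 \<alpha> \<beta> [u, v, w] = \<alpha> [u] * \<beta> [v, w] - \<alpha> [v] * \<beta> [u, w] + \<alpha> [w] * \<beta> [u, v]"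
proof -
  have S: "{..<1 + 2} = insert 0 (insert 1 {2::nat})" by auto
  have f: "finite (insert 1 {2::nat})" "0 \<notin> insert 1 {2::nat}" "finite {2::nat}" "1 \<notin> {2::nat}" by auto
  show ?thesis
    unfolding wedge_def S sum_over_permutations_insert[OF f(1,2)] sum_over_permutations_insert[OF f(3,4)]
    by (simp add: permutes_sing sign_swap_id sign_compose permutation_swap_id permutation_compose transpose_def upt_rec
        sign_id fact_numeral assms[of v u] assms[of w v] assms[of w u] eval_nat_numeral)
qed

text \<open>By skewness the 24 permutations fall into six shuffles with four equal terms each, which
  cancels the normalising factor 1/4.\<close>

lemma wedge_2_2:
  assumes \<alpha>: "\<And>u v. \<alpha> [u, v] = - \<alpha> [v, u]" and \<beta>: "\<And>u v. \<beta> [u, v] = - \<beta> [v, u]"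
  shows "wedge 2 2 \<alpha> \<beta> [a, b, c, d] = \<alpha> [a, b] * \<beta> [c, d] - \<alpha> [a, c] * \<beta> [b, d] + \<alpha> [a, d] * \<beta> [b, c]
     + \<alpha> [b, c] * \<beta> [a, d] - \<alpha> [b, d] * \<beta> [a, c] + \<alpha> [c, d] * \<beta> [a, b]"
proof -
  have S: "{..<2 + 2} = insert 0 (insert 1 (insert 2 {3::nat}))" by auto
  have f: "finite (insert 1 (insert 2 {3::nat}))" "0 \<notin> insert 1 (insert 2 {3::nat})"
    "finite (insert 2 {3::nat})" "1 \<notin> insert 2 {3::nat}" "finite {3::nat}" "2 \<notin> {3::nat}" by auto
  have s: "\<alpha> [b, a] = - \<alpha> [a, b]" "\<alpha> [c, a] = - \<alpha> [a, c]" "\<alpha> [d, a] = - \<alpha> [a, d]"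
    "\<alpha> [c, b] = - \<alpha> [b, c]" "\<alpha> [d, b] = - \<alpha> [b, d]" "\<alpha> [d, c] = - \<alpha> [c, d]"
    "\<beta> [b, a] = - \<beta> [a, b]" "\<beta> [c, a] = - \<beta> [a, c]" "\<beta> [d, a] = - \<beta> [a, d]"
    "\<beta> [c, b] = - \<beta> [b, c]" "\<beta> [d, b] = - \<beta> [b, d]" "\<beta> [d, c] = - \<beta> [c, d]"
    by (rule \<alpha> \<beta>)+
  show ?thesis
    unfolding wedge_def S sum_over_permutations_insert[OF f(1,2)] sum_over_permutations_insert[OF f(3,4)]
      sum_over_permutations_insert[OF f(5,6)]
    by (simp add: permutes_sing sign_swap_id sign_compose permutation_swap_id permutation_compose transpose_def upt_rec
        sign_id fact_numeral s eval_nat_numeral)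
qed

lemma ext_deriv_2_form:
  "ext_deriv \<alpha> c x [u, v, w] = frechet_derivative (\<lambda>y. \<alpha> c y [v, w]) (at x) u
     - frechet_derivative (\<lambda>y. \<alpha> c y [u, w]) (at x) v + frechet_derivative (\<lambda>y. \<alpha> c y [u, v]) (at x) w"
  by (simp add: ext_deriv_def lessThan_Suc)

lemma ext_deriv_3_form:
  "ext_deriv \<alpha> c x [u, v, w, z] = frechet_derivative (\<lambda>y. \<alpha> c y [v, w, z]) (at x) u
     - frechet_derivative (\<lambda>y. \<alpha> c y [u, w, z]) (at x) v + frechet_derivative (\<lambda>y. \<alpha> c y [u, v, z]) (at x) w
     - frechet_derivative (\<lambda>y. \<alpha> c y [u, v, w]) (at x) z"
  by (simp add: ext_deriv_def lessThan_Suc)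

lemma endo_act_2_form: "endo_act E T [u, v] = - (T [E u, v] + T [u, E v])"
  by (simp add: endo_act_def lessThan_Suc)

lemma endo_act_3_form: "endo_act E T [u, v, w] = - (T [E u, v, w] + T [u, E v, w] + T [u, v, E w])"
  by (simp add: endo_act_def lessThan_Suc)

lemma length_eq_numeral:
  "length xs = 2 \<longleftrightarrow> (\<exists>u v. xs = [u, v])"
  "length xs = 3 \<longleftrightarrow> (\<exists>u v w. xs = [u, v, w])"
  "length xs = 4 \<longleftrightarrow> (\<exists>u v w z. xs = [u, v, w, z])"
  by (auto simp: eval_nat_numeral length_Suc_conv)

lemma alternating_form_2_skew:
  assumes "alternating_form 2 T"
  shows "T [u, v] = - T [v, u]"
proof -
  have "multilinear_form 2 T" and z: "\<And>w. T [w, w] = 0"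
    using assms unfolding alternating_form_def by auto
  note lin = multilinear_form_2[OF this(1)]
  have "T [u + v, u + v] = T [u, u] + T [u, v] + (T [v, u] + T [v, v])"
    by (simp add: linear_add[OF lin(1)] linear_add[OF lin(2)])
  then show ?thesis by (simp add: z eq_neg_iff_add_eq_0)
qed

section \<open>Linear algebra of the torsion\<close>

declare One_nat_def [simp del]

lemma sum_1_6: "(\<Sum>l=1..6. f l) = f 1 + f 2 + f 3 + f 4 + f 5 + f (6::nat)"
  for f :: "nat \<Rightarrow> 'a::comm_monoid_add"
  by (simp add: eval_nat_numeral One_nat_def)

lemma in_1_6_iff: "(i::nat) \<in> {1..6} \<longleftrightarrow> i = 1 \<or> i = 2 \<or> i = 3 \<or> i = 4 \<or> i = 5 \<or> i = 6"
  by auto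

text \<open>For \<open>p i = e\<^sup>i\<close> these are \<open>\<omega>\<close> (\<open>sympl\<close>), \<open>\<psi>\<close> (\<open>volf\<close>) and, for a 2-form \<open>q\<close> in frame components,
  \<open>q \<and> \<omega>\<close> (\<open>wedge_sympl\<close>); \<open>dsympl\<close> and \<open>dvolf\<close> are the derivatives when \<open>p\<close> has derivative \<open>p'\<close>,
  and \<open>alt_dsympl\<close>, \<open>alt_dvolf\<close> the resulting exterior derivatives.\<close>

definition sympl :: "(nat \<Rightarrow> 'v \<Rightarrow> real) \<Rightarrow> 'v \<Rightarrow> 'v \<Rightarrow> real" where
  "sympl p u v = (p 1 u * p 2 v - p 1 v * p 2 u) + (p 3 u * p 4 v - p 3 v * p 4 u)
     + (p 5 u * p 6 v - p 5 v * p 6 u)"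

definition dsympl :: "(nat \<Rightarrow> 'v \<Rightarrow> real) \<Rightarrow> (nat \<Rightarrow> 'v \<Rightarrow> real) \<Rightarrow> 'v \<Rightarrow> 'v \<Rightarrow> real" where
  "dsympl p p' u v =
     (p' 1 u * p 2 v + p 1 u * p' 2 v - p' 1 v * p 2 u - p 1 v * p' 2 u)
     + (p' 3 u * p 4 v + p 3 u * p' 4 v - p' 3 v * p 4 u - p 3 v * p' 4 u)
     + (p' 5 u * p 6 v + p 5 u * p' 6 v - p' 5 v * p 6 u - p 5 v * p' 6 u)"

text \<open>For \<open>p i = e\<^sup>i\<close> the values \<open>m = 1, 2, 3\<close> give the three
  complex factors of \<psi>.\<close>

definition zeta :: "(nat \<Rightarrow> 'v \<Rightarrow> real) \<Rightarrow> nat \<Rightarrow> 'v \<Rightarrow> complex" where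
  "zeta p m u = Complex (p (2 * m - 1) u) (p (2 * m) u)"

definition det3 :: "('v \<Rightarrow> complex) \<Rightarrow> ('v \<Rightarrow> complex) \<Rightarrow> ('v \<Rightarrow> complex) \<Rightarrow> 'v \<Rightarrow> 'v \<Rightarrow> 'v \<Rightarrow> complex" where
  "det3 a b c u v w = a u * (b v * c w - b w * c v) - a v * (b u * c w - b w * c u)
     + a w * (b u * c v - b v * c u)"

definition volf :: "(nat \<Rightarrow> 'v \<Rightarrow> real) \<Rightarrow> 'v \<Rightarrow> 'v \<Rightarrow> 'v \<Rightarrow> complex" where
  "volf p = det3 (zeta p 1) (zeta p 2) (zeta p 3)"

definition dvolf :: "(nat \<Rightarrow> 'v \<Rightarrow> real) \<Rightarrow> (nat \<Rightarrow> 'v \<Rightarrow> real) \<Rightarrow> 'v \<Rightarrow> 'v \<Rightarrow> 'v \<Rightarrow> complex" where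
  "dvolf p p' u v w = det3 (zeta p' 1) (zeta p 2) (zeta p 3) u v w
     + det3 (zeta p 1) (zeta p' 2) (zeta p 3) u v w + det3 (zeta p 1) (zeta p 2) (zeta p' 3) u v w"

text \<open>The coframe evaluated on its dual frame; put in place of \<open>p\<close>, it turns
  forms on vectors into arrays of frame components.\<close>

definition kron :: "nat \<Rightarrow> nat \<Rightarrow> real" where
  "kron i j = (if i = j then 1 else 0)"

text \<open>Together with \<open>jsgn\<close> this encodes J on the dual frame: J maps
  \<open>F a\<close> to \<open>jsgn a\<close> times \<open>F (jidx a)\<close>.\<close>

definition jidx :: "nat \<Rightarrow> nat" where
  "jidx j = (if odd j then j + 1 else j - 1)"

definition jsgn :: "nat \<Rightarrow> real" where
  "jsgn j = (if odd j then 1 else - 1)"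

definition alt_dsympl :: "(nat \<Rightarrow> nat \<Rightarrow> nat \<Rightarrow> real) \<Rightarrow> nat \<Rightarrow> nat \<Rightarrow> nat \<Rightarrow> real" where
  "alt_dsympl A a b c = dsympl kron (A a) b c - dsympl kron (A b) a c + dsympl kron (A c) a b"

definition alt_dvolf :: "(nat \<Rightarrow> nat \<Rightarrow> nat \<Rightarrow> real) \<Rightarrow> nat \<Rightarrow> nat \<Rightarrow> nat \<Rightarrow> nat \<Rightarrow> complex" where
  "alt_dvolf A a b c d = dvolf kron (A a) b c d - dvolf kron (A b) a c d + dvolf kron (A c) a b d
     - dvolf kron (A d) a b c"

definition wedge_sympl :: "(nat \<Rightarrow> nat \<Rightarrow> real) \<Rightarrow> nat \<Rightarrow> nat \<Rightarrow> nat \<Rightarrow> nat \<Rightarrow> real" where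
  "wedge_sympl q a b c d = q a b * sympl kron c d - q a c * sympl kron b d + q a d * sympl kron b c
     + q b c * sympl kron a d - q b d * sympl kron a c + q c d * sympl kron a b"

text \<open>If \<open>A k i j\<close> is the derivative of \<open>e\<^sup>i\<close> applied to the frame vector \<open>F\<^sub>j\<close> in direction \<open>F\<^sub>k\<close>,
  this is the \<open>l\<close>-th component of the derivative of \<open>J F\<^sub>a\<close>, obtained by differentiating
  \<open>e\<^sup>l (J u) = - e\<^sup>l\<^sup>+\<^sup>1 u\<close> (\<open>l\<close> odd) and \<open>e\<^sup>l (J u) = e\<^sup>l\<^sup>-\<^sup>1 u\<close> (\<open>l\<close> even).\<close>

definition dJ :: "(nat \<Rightarrow> nat \<Rightarrow> nat \<Rightarrow> real) \<Rightarrow> nat \<Rightarrow> nat \<Rightarrow> nat \<Rightarrow> real" where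
  "dJ A k l a = (if odd l then - A k (l + 1) a else A k (l - 1) a) - jsgn a * A k l (jidx a)"

text \<open>Antisymmetrising over direction and arguments kills whatever is symmetric in the two.
  With \<open>G\<close> the Christoffel term, this is how absence of torsion lets covariant
  derivatives replace coordinate derivatives in d\<omega>; the next lemma does the same for
  d\<psi>.\<close>

lemma alt_dsympl_symmetric_part:
  assumes "\<And>k i j. A k i j = B k i j + G i k j" "\<And>i k j. G i k j = G i j k"
  shows "alt_dsympl A a b c = alt_dsympl B a b c"
  unfolding alt_dsympl_def dsympl_def
  by (simp add: assms(1) algebra_simps assms(2)[of _ b a] assms(2)[of _ c a] assms(2)[of _ c b])

lemma alt_dvolf_symmetric_part:
  assumes "\<And>k i j. A k i j = B k i j + G i k j" "\<And>i k j. G i k j = G i j k"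
  shows "alt_dvolf A a b c d = alt_dvolf B a b c d"
proof -
  define \<gamma> where "\<gamma> m k j = Complex (G (2 * m - 1) k j) (G (2 * m) k j)" for m k j
  have z: "zeta (A k) m j = zeta (B k) m j + \<gamma> m k j" for k m j
    by (simp add: zeta_def \<gamma>_def assms(1) complex_eq_iff)
  have s: "\<gamma> m b a = \<gamma> m a b" "\<gamma> m c a = \<gamma> m a c" "\<gamma> m c b = \<gamma> m b c"
    "\<gamma> m d a = \<gamma> m a d" "\<gamma> m d b = \<gamma> m b d" "\<gamma> m d c = \<gamma> m c d" for m
    by (simp_all add: \<gamma>_def assms(2)[of _ b a] assms(2)[of _ c a] assms(2)[of _ c b]
      assms(2)[of _ d a] assms(2)[of _ d b] assms(2)[of _ d c])
  show ?thesis
    unfolding alt_dvolf_def dvolf_def det3_def z s by (simp add: algebra_simps)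
qed

lemma zeta_numeral:
  "zeta p 1 u = Complex (p 1 u) (p 2 u)"
  "zeta p 2 u = Complex (p 3 u) (p 4 u)"
  "zeta p 3 u = Complex (p 5 u) (p 6 u)"
  by (simp_all add: zeta_def One_nat_def)

lemma zeta_kron:
  "zeta kron 1 1 = 1" "zeta kron 1 2 = \<i>" "zeta kron 1 3 = 0" "zeta kron 1 4 = 0" "zeta kron 1 5 = 0" "zeta kron 1 6 = 0"
  "zeta kron 2 1 = 0" "zeta kron 2 2 = 0" "zeta kron 2 3 = 1" "zeta kron 2 4 = \<i>" "zeta kron 2 5 = 0" "zeta kron 2 6 = 0"
  "zeta kron 3 1 = 0" "zeta kron 3 2 = 0" "zeta kron 3 3 = 0" "zeta kron 3 4 = 0" "zeta kron 3 5 = 1" "zeta kron 3 6 = \<i>"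
  by (simp_all add: zeta_numeral kron_def complex_eq_iff)

text \<open>The conclusion cuts \<open>su(3)\<close> out of \<open>so(6)\<close>: the first six
  equations say that the skew matrix \<open>A k\<close> commutes with J, the last that its complex
  trace is zero.\<close>

lemma torsion_algebra:
  assumes A: "\<And>k i j. i \<in> {1..6} \<Longrightarrow> j \<in> {1..6} \<Longrightarrow> A k i j = - A k j i"
    and d\<omega>: "\<And>a b c. a \<in> {1..6} \<Longrightarrow> b \<in> {1..6} \<Longrightarrow> c \<in> {1..6} \<Longrightarrow> alt_dsympl A a b c = 0"
    and d\<psi>: "\<And>a b c d. a \<in> {1..6} \<Longrightarrow> b \<in> {1..6} \<Longrightarrow> c \<in> {1..6} \<Longrightarrow> d \<in> {1..6} \<Longrightarrow>
      alt_dvolf A a b c d = 0"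
    and k: "k \<in> {1..6}"
  shows "A k 1 3 = A k 2 4 \<and> A k 1 4 = - A k 2 3 \<and> A k 1 5 = A k 2 6 \<and> A k 1 6 = - A k 2 5 \<and>
    A k 3 5 = A k 4 6 \<and> A k 3 6 = - A k 4 5 \<and> A k 1 2 + A k 3 4 + A k 5 6 = 0"
proof -
  have A': "A k j i = - A k i j" if "i < j" "1 \<le> i" "j \<le> 6" for k i j
    using A[of j i k] that by simp
  have A0: "A k i i = 0" if "1 \<le> i" "i \<le> 6" for k i
    using A[of i i k] that by simp
  note eval [simp] = alt_dsympl_def alt_dvolf_def dsympl_def dvolf_def det3_def zeta_kron zeta_numeral[of "A _"] kron_def A' A0
  \<comment> \<open>\<open>w\<close>: components of \<open>d\<omega>\<close>; \<open>p\<close>, \<open>m\<close>: components of the real and imaginary part of \<open>d\<psi>\<close>.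
    Each conjunct below is half a signed sum of three or four of them.\<close>
  note m1234 = arg_cong[OF d\<psi>[of 1 2 3 4], of Im, simplified]
  note m1235 = arg_cong[OF d\<psi>[of 1 2 3 5], of Im, simplified]
  note m1236 = arg_cong[OF d\<psi>[of 1 2 3 6], of Im, simplified]
  note m1245 = arg_cong[OF d\<psi>[of 1 2 4 5], of Im, simplified]
  note m1256 = arg_cong[OF d\<psi>[of 1 2 5 6], of Im, simplified]
  note m1346 = arg_cong[OF d\<psi>[of 1 3 4 6], of Im, simplified]
  note m1356 = arg_cong[OF d\<psi>[of 1 3 5 6], of Im, simplified]
  note m1456 = arg_cong[OF d\<psi>[of 1 4 5 6], of Im, simplified]
  note m2345 = arg_cong[OF d\<psi>[of 2 3 4 5], of Im, simplified]
  note m2346 = arg_cong[OF d\<psi>[of 2 3 4 6], of Im, simplified]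
  note m2456 = arg_cong[OF d\<psi>[of 2 4 5 6], of Im, simplified]
  note m3456 = arg_cong[OF d\<psi>[of 3 4 5 6], of Im, simplified]
  note p1234 = arg_cong[OF d\<psi>[of 1 2 3 4], of Re, simplified]
  note p1235 = arg_cong[OF d\<psi>[of 1 2 3 5], of Re, simplified]
  note p1236 = arg_cong[OF d\<psi>[of 1 2 3 6], of Re, simplified]
  note p1245 = arg_cong[OF d\<psi>[of 1 2 4 5], of Re, simplified]
  note p1256 = arg_cong[OF d\<psi>[of 1 2 5 6], of Re, simplified]
  note p1345 = arg_cong[OF d\<psi>[of 1 3 4 5], of Re, simplified]
  note p1346 = arg_cong[OF d\<psi>[of 1 3 4 6], of Re, simplified]
  note p1356 = arg_cong[OF d\<psi>[of 1 3 5 6], of Re, simplified]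
  note p2345 = arg_cong[OF d\<psi>[of 2 3 4 5], of Re, simplified]
  note p2356 = arg_cong[OF d\<psi>[of 2 3 5 6], of Re, simplified]
  note p2456 = arg_cong[OF d\<psi>[of 2 4 5 6], of Re, simplified]
  note p3456 = arg_cong[OF d\<psi>[of 3 4 5 6], of Re, simplified]
  note w123 = d\<omega>[of 1 2 3, simplified]
  note w124 = d\<omega>[of 1 2 4, simplified]
  note w125 = d\<omega>[of 1 2 5, simplified]
  note w126 = d\<omega>[of 1 2 6, simplified]
  note w134 = d\<omega>[of 1 3 4, simplified]
  note w135 = d\<omega>[of 1 3 5, simplified]
  note w136 = d\<omega>[of 1 3 6, simplified]
  note w145 = d\<omega>[of 1 4 5, simplified]
  note w146 = d\<omega>[of 1 4 6, simplified]
  note w156 = d\<omega>[of 1 5 6, simplified]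
  note w234 = d\<omega>[of 2 3 4, simplified]
  note w235 = d\<omega>[of 2 3 5, simplified]
  note w236 = d\<omega>[of 2 3 6, simplified]
  note w245 = d\<omega>[of 2 4 5, simplified]
  note w246 = d\<omega>[of 2 4 6, simplified]
  note w256 = d\<omega>[of 2 5 6, simplified]
  note w345 = d\<omega>[of 3 4 5, simplified]
  note w346 = d\<omega>[of 3 4 6, simplified]
  note w356 = d\<omega>[of 3 5 6, simplified]
  note w456 = d\<omega>[of 4 5 6, simplified]
  have k1: "A 1 1 3 = A 1 2 4 \<and> A 1 1 4 = - A 1 2 3 \<and> A 1 1 5 = A 1 2 6 \<and> A 1 1 6 = - A 1 2 5 \<and> A 1 3 5 = A 1 4 6 \<and> A 1 3 6 = - A 1 4 5 \<and> A 1 1 2 + A 1 3 4 + A 1 5 6 = 0"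
    using m1236 m1245 m1356 m1456 m2345 m2346 m3456 p1345 p1346 p2356 p2456 p3456 w123 w124 w125 w126 w135 w136
      w145 w146 w234 w256
    by (intro conjI; linarith)
  have k2: "A 2 1 3 = A 2 2 4 \<and> A 2 1 4 = - A 2 2 3 \<and> A 2 1 5 = A 2 2 6 \<and> A 2 1 6 = - A 2 2 5 \<and> A 2 3 5 = A 2 4 6 \<and> A 2 3 6 = - A 2 4 5 \<and> A 2 1 2 + A 2 3 4 + A 2 5 6 = 0"
    using m1356 m1456 m2345 m2346 m3456 p1236 p1245 p1345 p1346 p2356 p2456 p3456 w123 w124 w125 w126 w134 w156
      w235 w236 w245 w246
    by (intro conjI; linarith)
  have k3: "A 3 1 3 = A 3 2 4 \<and> A 3 1 4 = - A 3 2 3 \<and> A 3 1 5 = A 3 2 6 \<and> A 3 1 6 = - A 3 2 5 \<and> A 3 3 5 = A 3 4 6 \<and> A 3 3 6 = - A 3 4 5 \<and> A 3 1 2 + A 3 3 4 + A 3 5 6 = 0"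
    using m1235 m1245 m1256 m1346 m1456 m2345 m2456 p1235 p1245 p1256 p1356 p2356 w124 w134 w135 w136 w234 w235
      w236 w345 w346 w456
    by (intro conjI; linarith)
  have k4: "A 4 1 3 = A 4 2 4 \<and> A 4 1 4 = - A 4 2 3 \<and> A 4 1 5 = A 4 2 6 \<and> A 4 1 6 = - A 4 2 5 \<and> A 4 3 5 = A 4 4 6 \<and> A 4 3 6 = - A 4 4 5 \<and> A 4 1 2 + A 4 3 4 + A 4 5 6 = 0"
    using m1235 m1245 m1256 m1456 m2456 p1235 p1245 p1256 p1346 p1356 p2345 p2356 w123 w134 w145 w146 w234 w245
      w246 w345 w346 w356
    by (intro conjI; linarith)
  have k5: "A 5 1 3 = A 5 2 4 \<and> A 5 1 4 = - A 5 2 3 \<and> A 5 1 5 = A 5 2 6 \<and> A 5 1 6 = - A 5 2 5 \<and> A 5 3 5 = A 5 4 6 \<and> A 5 3 6 = - A 5 4 5 \<and> A 5 1 2 + A 5 3 4 + A 5 5 6 = 0"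
    using m1234 m1235 m1236 m1346 m2346 p1234 p1235 p1236 p1345 p1356 p2345 p2456 w126 w135 w145 w156 w235 w245
      w256 w346 w356 w456
    by (intro conjI; linarith)
  have k6: "A 6 1 3 = A 6 2 4 \<and> A 6 1 4 = - A 6 2 3 \<and> A 6 1 5 = A 6 2 6 \<and> A 6 1 6 = - A 6 2 5 \<and> A 6 3 5 = A 6 4 6 \<and> A 6 3 6 = - A 6 4 5 \<and> A 6 1 2 + A 6 3 4 + A 6 5 6 = 0"
    using m1234 m1235 m1236 m1346 m1356 m2346 m2456 p1234 p1235 p1236 p1345 p2345 w125 w136 w146 w156 w236 w246
      w256 w345 w356 w456
    by (intro conjI; linarith)
  have "k = 1 \<or> k = 2 \<or> k = 3 \<or> k = 4 \<or> k = 5 \<or> k = 6" using k by auto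
  then show ?thesis using k1 k2 k3 k4 k5 k6 by blast
qed

text \<open>This is \<open>d(\<pi> \<and> \<psi>\<^sub>+) = d\<pi> \<and> \<psi>\<^sub>+ + \<pi> \<and> d\<psi>\<^sub>+\<close> at a point, where the left-hand side vanishes because
  \<open>\<pi>\<close> is of type (1,1), together with \<open>\<pi> \<and> \<pi> \<and> \<omega> = - \<bar>\<pi>\<bar>\<^sup>2 vol\<close>. Here \<open>M k\<close> is the derivative of \<open>\<pi>\<close> in
  direction \<open>F\<^sub>k\<close>; primitivity of \<open>\<pi>\<close> follows from \<open>d\<omega> = 0\<close>.\<close>

lemma torsion_form_algebra:
  assumes q: "\<And>a b. q a b = - q b a"
    and M: "\<And>k a b. M k a b = - M k b a"
    and qJ: "\<And>a b. a \<in> {1..6} \<Longrightarrow> b \<in> {1..6} \<Longrightarrow> jsgn a * jsgn b * q (jidx a) (jidx b) = q a b"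
    and MJ: "\<And>k a b. k \<in> {1..6} \<Longrightarrow> a \<in> {1..6} \<Longrightarrow> b \<in> {1..6} \<Longrightarrow>
      jsgn a * jsgn b * M k (jidx a) (jidx b)
      + (\<Sum>l=1..6. dJ B k l a * jsgn b * q l (jidx b)) + (\<Sum>l=1..6. dJ B k l b * jsgn a * q (jidx a) l) = M k a b"
    and d\<pi>: "\<And>a b c. a \<in> {1..6} \<Longrightarrow> b \<in> {1..6} \<Longrightarrow> c \<in> {1..6} \<Longrightarrow> M a b c - M b a c + M c a b = 0"
    and d\<omega>: "\<And>a b c. a \<in> {1..6} \<Longrightarrow> b \<in> {1..6} \<Longrightarrow> c \<in> {1..6} \<Longrightarrow> alt_dsympl B a b c = 0"
    and d\<psi>: "\<And>a b c d. a \<in> {1..6} \<Longrightarrow> b \<in> {1..6} \<Longrightarrow> c \<in> {1..6} \<Longrightarrow> d \<in> {1..6} \<Longrightarrow>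
      alt_dvolf B a b c d = - of_real (wedge_sympl q a b c d)"
    and ab: "a \<in> {1..6}" "b \<in> {1..6}"
  shows "q a b = 0"
proof -
  have q': "q b a = - q a b" if "a < b" for a b by (rule q)
  have M': "M k b a = - M k a b" if "a < b" for k a b by (rule M)
  have q0: "q a a = 0" for a using q[of a a] by simp
  have M0: "M k a a = 0" for k a using M[of k a a] by simp
  note J [simp] = jsgn_def jidx_def
  \<comment> \<open>Type (1,1) in the frame: nine independent components remain, as many as the
    dimension of \<open>u(3)\<close>.\<close>
  have pat: "q 2 4 = q 1 3" "q 2 3 = - q 1 4" "q 2 6 = q 1 5" "q 2 5 = - q 1 6" "q 4 6 = q 3 5" "q 4 5 = - q 3 6"
    using qJ[of 1 3] qJ[of 1 4] qJ[of 1 5] qJ[of 1 6] qJ[of 3 5] qJ[of 3 6] by (simp_all add: J)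
  note eval [simp] = alt_dsympl_def alt_dvolf_def dsympl_def dvolf_def det3_def zeta_kron zeta_numeral[of "B _"] kron_def
    wedge_sympl_def sympl_def One_nat_def[symmetric] sum_1_6 dJ_def M' M0 q' q0 pat
  note p1234 = arg_cong[OF d\<psi>[of 1 2 3 4], of Re, simplified]
  note p1235 = arg_cong[OF d\<psi>[of 1 2 3 5], of Re, simplified]
  note p1236 = arg_cong[OF d\<psi>[of 1 2 3 6], of Re, simplified]
  note p1245 = arg_cong[OF d\<psi>[of 1 2 4 5], of Re, simplified]
  note p1246 = arg_cong[OF d\<psi>[of 1 2 4 6], of Re, simplified]
  note p1256 = arg_cong[OF d\<psi>[of 1 2 5 6], of Re, simplified]
  note p1345 = arg_cong[OF d\<psi>[of 1 3 4 5], of Re, simplified]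
  note p1346 = arg_cong[OF d\<psi>[of 1 3 4 6], of Re, simplified]
  note p1356 = arg_cong[OF d\<psi>[of 1 3 5 6], of Re, simplified]
  note p1456 = arg_cong[OF d\<psi>[of 1 4 5 6], of Re, simplified]
  note p2345 = arg_cong[OF d\<psi>[of 2 3 4 5], of Re, simplified]
  note p2346 = arg_cong[OF d\<psi>[of 2 3 4 6], of Re, simplified]
  note p2356 = arg_cong[OF d\<psi>[of 2 3 5 6], of Re, simplified]
  note p2456 = arg_cong[OF d\<psi>[of 2 4 5 6], of Re, simplified]
  note p3456 = arg_cong[OF d\<psi>[of 3 4 5 6], of Re, simplified]
  note w136 = d\<omega>[of 1 3 6, simplified]
  note w145 = d\<omega>[of 1 4 5, simplified]
  note w235 = d\<omega>[of 2 3 5, simplified]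
  note w246 = d\<omega>[of 2 4 6, simplified]
  have t: "q 1 2 + q 3 4 + q 5 6 = 0"
    using p1234 p1256 p3456 w136 w145 w235 w246 by linarith
  \<comment> \<open>The type condition, differentiated. Each instance relates two values of
    \<open>M\<close> that J exchanges up to sign; the six together eliminate all twelve values of
    \<open>M\<close> in the components of d\<pi> listed next.\<close>
  note R136 = MJ[of 1 3 6, simplified, simplified mult_minus_left mult_minus_right minus_diff_eq algebra_simps]
  note R235 = MJ[of 2 3 5, simplified, simplified mult_minus_left mult_minus_right minus_diff_eq algebra_simps]
  note R316 = MJ[of 3 1 6, simplified, simplified mult_minus_left mult_minus_right minus_diff_eq algebra_simps]
  note R415 = MJ[of 4 1 5, simplified, simplified mult_minus_left mult_minus_right minus_diff_eq algebra_simps]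
  note R514 = MJ[of 5 1 4, simplified, simplified mult_minus_left mult_minus_right minus_diff_eq algebra_simps]
  note R613 = MJ[of 6 1 3, simplified, simplified mult_minus_left mult_minus_right minus_diff_eq algebra_simps]
  note d246 = d\<pi>[of 2 4 6, simplified]
  note d235 = d\<pi>[of 2 3 5, simplified]
  note d145 = d\<pi>[of 1 4 5, simplified]
  note d136 = d\<pi>[of 1 3 6, simplified]
  have e12: "B 3 1 5 - B 3 2 6 - B 4 1 6 - B 4 2 5 - B 5 1 3 + B 5 2 4 + B 6 1 4 + B 6 2 3 = q 1 2"
    using p3456 t by linarith
  have e34: "- B 1 3 5 + B 1 4 6 + B 2 3 6 + B 2 4 5 + B 5 3 1 - B 5 4 2 - B 6 3 2 - B 6 4 1 = q 3 4"
    using p1256 t by linarith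
  have e56: "B 1 5 3 - B 1 6 4 - B 2 5 4 - B 2 6 3 - B 3 5 1 + B 3 6 2 + B 4 5 2 + B 4 6 1 = q 5 6"
    using p1234 t by linarith
  have e13: "- B 1 1 6 - B 1 2 5 - B 2 1 5 + B 2 2 6 - B 3 3 6 - B 3 4 5 - B 4 3 5 + B 4 4 6 + B 5 1 2 + B 5 2 1 + B 5 3 4 + B 5 4 3 + B 6 1 1 - B 6 2 2 + B 6 3 3 - B 6 4 4 = 2 * q 1 3"
    using p1356 p2456 by linarith
  have e14: "- B 1 1 5 + B 1 2 6 + B 2 1 6 + B 2 2 5 + B 3 3 5 - B 3 4 6 - B 4 3 6 - B 4 4 5 + B 5 1 1 - B 5 2 2 - B 5 3 3 + B 5 4 4 - B 6 1 2 - B 6 2 1 + B 6 3 4 + B 6 4 3 = 2 * q 1 4"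
    using p1456 p2356 by linarith
  have e15: "B 1 1 4 + B 1 2 3 + B 2 1 3 - B 2 2 4 - B 3 1 2 - B 3 2 1 - B 3 5 6 - B 3 6 5 - B 4 1 1 + B 4 2 2 - B 4 5 5 + B 4 6 6 + B 5 5 4 + B 5 6 3 + B 6 5 3 - B 6 6 4 = 2 * q 1 5"
    using p1345 p2346 by linarith
  have e16: "B 1 1 3 - B 1 2 4 - B 2 1 4 - B 2 2 3 - B 3 1 1 + B 3 2 2 + B 3 5 5 - B 3 6 6 + B 4 1 2 + B 4 2 1 - B 4 5 6 - B 4 6 5 - B 5 5 3 + B 5 6 4 + B 6 5 4 + B 6 6 3 = 2 * q 1 6"
    using p1346 p2345 by linarith
  have e35: "B 1 3 4 + B 1 4 3 + B 1 5 6 + B 1 6 5 + B 2 3 3 - B 2 4 4 + B 2 5 5 - B 2 6 6 - B 3 3 2 - B 3 4 1 - B 4 3 1 + B 4 4 2 - B 5 5 2 - B 5 6 1 - B 6 5 1 + B 6 6 2 = 2 * q 3 5"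
    using p1235 p1246 by linarith
  have e36: "B 1 3 3 - B 1 4 4 - B 1 5 5 + B 1 6 6 - B 2 3 4 - B 2 4 3 + B 2 5 6 + B 2 6 5 - B 3 3 1 + B 3 4 2 + B 4 3 2 + B 4 4 1 + B 5 5 1 - B 5 6 2 - B 6 5 2 - B 6 6 1 = 2 * q 3 6"
    using p1236 p1245 by linarith
  have "q 1 2 * (B 3 1 5 - B 3 2 6 - B 4 1 6 - B 4 2 5 - B 5 1 3 + B 5 2 4 + B 6 1 4 + B 6 2 3)
      + q 3 4 * (- B 1 3 5 + B 1 4 6 + B 2 3 6 + B 2 4 5 + B 5 3 1 - B 5 4 2 - B 6 3 2 - B 6 4 1)
      + q 5 6 * (B 1 5 3 - B 1 6 4 - B 2 5 4 - B 2 6 3 - B 3 5 1 + B 3 6 2 + B 4 5 2 + B 4 6 1)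
      + q 1 3 * (- B 1 1 6 - B 1 2 5 - B 2 1 5 + B 2 2 6 - B 3 3 6 - B 3 4 5 - B 4 3 5 + B 4 4 6 + B 5 1 2 + B 5 2 1 + B 5 3 4 + B 5 4 3 + B 6 1 1 - B 6 2 2 + B 6 3 3 - B 6 4 4)
      + q 1 4 * (- B 1 1 5 + B 1 2 6 + B 2 1 6 + B 2 2 5 + B 3 3 5 - B 3 4 6 - B 4 3 6 - B 4 4 5 + B 5 1 1 - B 5 2 2 - B 5 3 3 + B 5 4 4 - B 6 1 2 - B 6 2 1 + B 6 3 4 + B 6 4 3)
      + q 1 5 * (B 1 1 4 + B 1 2 3 + B 2 1 3 - B 2 2 4 - B 3 1 2 - B 3 2 1 - B 3 5 6 - B 3 6 5 - B 4 1 1 + B 4 2 2 - B 4 5 5 + B 4 6 6 + B 5 5 4 + B 5 6 3 + B 6 5 3 - B 6 6 4)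
      + q 1 6 * (B 1 1 3 - B 1 2 4 - B 2 1 4 - B 2 2 3 - B 3 1 1 + B 3 2 2 + B 3 5 5 - B 3 6 6 + B 4 1 2 + B 4 2 1 - B 4 5 6 - B 4 6 5 - B 5 5 3 + B 5 6 4 + B 6 5 4 + B 6 6 3)
      + q 3 5 * (B 1 3 4 + B 1 4 3 + B 1 5 6 + B 1 6 5 + B 2 3 3 - B 2 4 4 + B 2 5 5 - B 2 6 6 - B 3 3 2 - B 3 4 1 - B 4 3 1 + B 4 4 2 - B 5 5 2 - B 5 6 1 - B 6 5 1 + B 6 6 2)
      + q 3 6 * (B 1 3 3 - B 1 4 4 - B 1 5 5 + B 1 6 6 - B 2 3 4 - B 2 4 3 + B 2 5 6 + B 2 6 5 - B 3 3 1 + B 3 4 2 + B 4 3 2 + B 4 4 1 + B 5 5 1 - B 5 6 2 - B 6 5 2 - B 6 6 1) = 0"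
    by (simp only: mult_minus_left mult_minus_right minus_diff_eq algebra_simps,
        insert d246 d235 d145 d136 R136 R235 R316 R415 R514 R613, linarith)
  \<comment> \<open>The squared norm of \<pi>; the factor 2 counts the components identified by
    \<open>pat\<close>.\<close>
  then have "(q 1 2 * q 1 2 + q 3 4 * q 3 4 + q 5 6 * q 5 6) + 2 * (q 1 3 * q 1 3 + q 1 4 * q 1 4 + q 1 5 * q 1 5
      + q 1 6 * q 1 6 + q 3 5 * q 3 5 + q 3 6 * q 3 6) = 0"
    unfolding e12 e34 e56 e13 e14 e15 e16 e35 e36 by (simp add: algebra_simps)
  then have "q 1 2 = 0 \<and> q 3 4 = 0 \<and> q 5 6 = 0 \<and> q 1 3 = 0 \<and> q 1 4 = 0 \<and> q 1 5 = 0 \<and> q 1 6 = 0 \<and> q 3 5 = 0 \<and> q 3 6 = 0"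
    by (simp only: add_nonneg_eq_0_iff zero_le_square add_nonneg_nonneg mult_nonneg_nonneg zero_le_numeral
        mult_eq_0_iff) simp
  moreover have "a = 1 \<or> a = 2 \<or> a = 3 \<or> a = 4 \<or> a = 5 \<or> a = 6" "b = 1 \<or> b = 2 \<or> b = 3 \<or> b = 4 \<or> b = 5 \<or> b = 6"
    using ab by auto
  ultimately show ?thesis using pat by (elim disjE) (simp_all)
qed

text \<open>The Ricci tensor of a curvature tensor with values in \<open>su(3)\<close> vanishes: with
  \<open>S b c = (\<Sum>a. Q (F a) b c (J (F a)))\<close>, the Bianchi identity and the vanishing of the complex trace make
  \<open>S\<close> symmetric, whereas \<open>S b c = Ric (J b) c\<close> is antisymmetric.\<close>

lemma su_curvature_trace_eq_zero:
  fixes Q :: "'v::real_vector \<Rightarrow> 'v \<Rightarrow> 'v \<Rightarrow> 'v \<Rightarrow> real" and F :: "nat \<Rightarrow> 'v"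
  assumes lin1: "\<And>v w z. linear (\<lambda>u. Q u v w z)" and lin4: "\<And>u v w. linear (\<lambda>z. Q u v w z)"
    and a1: "\<And>u v w z. Q u v w z = - Q v u w z" and a2: "\<And>u v w z. Q u v w z = - Q u v z w"
    and bianchi: "\<And>u v w z. Q u v w z + Q v w u z + Q w u v z = 0"
    and QJ: "\<And>u v w z. Q u v (J w) (J z) = Q u v w z" and J2: "\<And>u. J (J u) = - u"
    and JF: "J (F 1) = F 2" "J (F 3) = F 4" "J (F 5) = F 6"
    and tr: "\<And>u v. (\<Sum>a=1..6. Q u v (F a) (J (F a))) = 0"
  shows "(\<Sum>a=1..6. Q (F a) v w (F a)) = 0"
proof -
  \<comment> \<open>The classical octahedron argument: four Bianchi identities combined with the
    skewness in each pair.\<close>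
  have pair: "Q u v w z = Q w z u v" for u v w z
    using bianchi[of u v w z] bianchi[of v w z u] bianchi[of w z u v] bianchi[of z u v w]
      a2[of v w z u] a2[of u v z w] a2[of w z v u] a2[of z u v w]
      a1[of z v w u] a2[of v z w u] a1[of w u v z] a2[of u w v z]
    by linarith
  have n1: "Q (- u) v w z = - Q u v w z" and n4: "Q u v w (- z) = - Q u v w z" for u v w z
    using linear_neg[OF lin1[of v w z], of u] linear_neg[OF lin4[of u v w], of z] by auto
  have n3: "Q u v (- w) z = - Q u v w z" for u v w z
    using a2[of u v "- w" z] a2[of u v w z] n4[of u v z w] by simp
  have n2: "Q u (- v) w z = - Q u v w z" for u v w z
    using a1[of u "- v" w z] a1[of u v w z] n1[of v u w z] by simp
  have JJ: "Q (J u) (J v) w z = Q u v w z" for u v w z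
    using pair[of "J u" "J v" w z] pair[of w z u v] QJ[of w z u v] by simp
  have JF': "J (F 2) = - F 1" "J (F 4) = - F 3" "J (F 6) = - F 5"
    using J2[of "F 1"] J2[of "F 3"] J2[of "F 5"] by (simp_all add: JF)
  define Ric where "Ric b c = (\<Sum>a=1..6. Q (F a) b c (F a))" for b c
  define S where "S b c = (\<Sum>a=1..6. Q (F a) b c (J (F a)))" for b c
  have S_sym: "S b c = S c b" for b c
  proof -
    have "(\<Sum>a=1..6. Q (F a) b c (J (F a)) + Q b c (F a) (J (F a)) + Q c (F a) b (J (F a))) = 0"
      by (simp add: bianchi)
    moreover have "(\<Sum>a=1..6. Q c (F a) b (J (F a))) = - S c b"
      unfolding S_def by (subst a1) (simp add: sum_negf)
    ultimately show ?thesis by (simp add: sum.distrib tr S_def)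
  qed
  have Ric_sym: "Ric b c = Ric c b" for b c
    unfolding Ric_def
  proof (rule sum.cong[OF refl])
    fix a show "Q (F a) b c (F a) = Q (F a) c b (F a)"
      using pair[of "F a" b c "F a"] a1[of c "F a" "F a" b] a2[of "F a" c "F a" b] by simp
  qed
  have 1: "Ric b (J c) = - S b c" for b c
  proof -
    have "Q u b (J c) z = - Q u b c (J z)" for u z
      using QJ[of u b "J c" z, unfolded J2 n3] by simp
    then show ?thesis unfolding Ric_def S_def by (simp add: sum_negf)
  qed
  \<comment> \<open>J permutes the frame up to signs, and each sign occurs twice in a summand. So
    the sum may run over \<open>J (F a)\<close>, and then J is removed from the first two
    slots.\<close>
  have 2: "Ric (J b) c = S b c" for b c
  proof -
    have "Ric (J b) c = (\<Sum>a=1..6. Q (J (F a)) (J b) c (J (F a)))"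
      unfolding Ric_def sum_1_6 by (simp add: JF JF' n1 n4)
    then show ?thesis by (simp add: JJ S_def)
  qed
  have "S b c = 0" for b c
    using 1[of c b] 2[of b c] Ric_sym[of "J b" c] S_sym[of b c] by simp
  then have "Ric v (J (- J w)) = 0" by (simp add: 1)
  moreover have "J (- J w) = w"
  proof -
    have "J (- J w) = J (J (J (J w)))" by (simp only: J2[of "J w"])
    then show ?thesis by (simp only: J2 minus_minus)
  qed
  ultimately show ?thesis by (simp add: Ric_def)
qed

section \<open>Adapted coframes\<close>

lemma sympl_skew: "sympl p u v = - sympl p v u"
  by (simp add: sympl_def)

lemma has_derivative_Complex:
  assumes "(f has_derivative f') F" "(h has_derivative h') F"
  shows "((\<lambda>y. Complex (f y) (h y)) has_derivative (\<lambda>k. Complex (f' k) (h' k))) F"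
  unfolding Complex_eq
  by (intro has_derivative_add has_derivative_mult_right has_derivative_of_real assms)

locale su3_coframe = riemannian_chart g c U
  for g :: "('a, 6, real) tensor" and c :: "('a, 6) chart" and U :: "(real^6) set" +
  fixes J :: "('a, 6) endo_field" and \<psi> :: "('a, 6, complex) tensor"
    and W :: "(real^6) set" and e :: "nat \<Rightarrow> real^6 \<Rightarrow> (real^6) list \<Rightarrow> real"
  assumes open_W: "open W" and W_subset: "W \<subseteq> U"
    and coframe: "adapted_coframe g J \<psi> c W e"
begin

abbreviation \<theta> :: "real^6 \<Rightarrow> nat \<Rightarrow> real^6 \<Rightarrow> real" where "\<theta> y i v \<equiv> e i y [v]"

lemma in_U: "y \<in> W \<Longrightarrow> y \<in> U"
  using W_subset by blast

lemma coframe_linear: "i \<in> {1..6} \<Longrightarrow> y \<in> W \<Longrightarrow> linear (\<theta> y i)"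
  using coframe unfolding adapted_coframe_def by (intro multilinear_form_1) blast

lemma coframe_diff: "i \<in> {1..6} \<Longrightarrow> y \<in> W \<Longrightarrow> (\<lambda>y. \<theta> y i v) differentiable (at y)"
  using coframe unfolding adapted_coframe_def by (intro smooth_map_on_differentiable[where S = W]) blast+

lemma metric_coframe: "y \<in> W \<Longrightarrow> g c y [u, v] = (\<Sum>i=1..6. \<theta> y i u * \<theta> y i v)"
  using coframe unfolding adapted_coframe_def by blast

lemma fundamental_form_coframe: "y \<in> W \<Longrightarrow> fundamental_form g J c y [u, v] = sympl (\<theta> y) u v"
  using coframe unfolding adapted_coframe_def by (simp add: wedge_1_1 sympl_def)

lemma volume_form_coframe:
  assumes "y \<in> W"
  shows "\<psi> c y [u, v, w] = volf (\<theta> y) u v w"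
proof -
  have "\<psi> c y [u, v, w] = wedge 1 2 (\<lambda>us. Complex (e 1 y us) (e 2 y us))
     (wedge 1 1 (\<lambda>us. Complex (e 3 y us) (e 4 y us)) (\<lambda>us. Complex (e 5 y us) (e 6 y us))) [u, v, w]"
    using coframe assms unfolding adapted_coframe_def by simp
  then show ?thesis
    by (subst (asm) wedge_1_2) (simp_all add: wedge_1_1 volf_def det3_def zeta_numeral)
qed

lemma coframe_eq_zero:
  assumes y: "y \<in> W" and "\<And>i. i \<in> {1..6} \<Longrightarrow> \<theta> y i v = 0"
  shows "v = 0"
proof (rule ccontr)
  assume "v \<noteq> 0"
  then have "0 < g c y [v, v]" using metric_pos in_U[OF y] by blast
  then show False using assms by (simp add: metric_coframe)
qed

text \<open>Positivity of the metric gives the six covectors a trivial common kernel, so together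
  they form an injective, hence bijective, endomorphism; \<open>F\<close> consists of preimages of
  the standard basis.\<close>

lemma dual_frame_exists:
  assumes y: "y \<in> W"
  obtains F where "\<And>i j. i \<in> {1..6} \<Longrightarrow> j \<in> {1..6} \<Longrightarrow> \<theta> y i (F j) = kron i j"
proof -
  \<comment> \<open>Covectors are numbered by 1 to 6, coordinates by the six-element type
    \<open>6\<close>; \<open>h\<close> matches the two.\<close>
  obtain h :: "nat \<Rightarrow> 6" where h: "bij_betw h {1..6} UNIV"
    using ex_bij_betw_nat_finite_1[OF finite, of "UNIV :: 6 set"] by auto
  define k where "k = inv_into {1..6} h"
  have k: "k i \<in> {1..6}" "h (k i) = i" for i
    using inv_into_into[of i h "{1..6}"] f_inv_into_f[of i h "{1..6}"] bij_betw_imp_surj_on[OF h]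
    unfolding k_def by simp_all
  have kh: "k (h i) = i" if "i \<in> {1..6}" for i
    using h that unfolding k_def bij_betw_def by (simp add: inv_into_f_f)
  define E :: "real^6 \<Rightarrow> real^6" where "E v = (\<chi> i. \<theta> y (k i) v)" for v
  have "linear E"
    by (rule linearI)
      (simp_all add: E_def vec_eq_iff linear_add[OF coframe_linear[OF k(1) y]] linear_scale[OF coframe_linear[OF k(1) y]])
  moreover have "v = 0" if "E v = 0" for v
  proof (rule coframe_eq_zero[OF y])
    fix i :: nat assume "i \<in> {1..6}"
    then show "\<theta> y i v = 0" using that kh[of i] by (auto simp: E_def vec_eq_iff dest: spec[where x = "h i"])
  qed
  ultimately have "surj E"
    by (intro linear_injective_imp_surjective) (auto simp: linear_injective_0)
  then obtain G where G: "\<And>b. E (G b) = b" by (metis surjD)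
  show thesis
  proof (rule that)
    fix i j :: nat assume ij: "i \<in> {1..6}" "j \<in> {1..6}"
    have "\<theta> y i (G (axis (h j) 1)) = E (G (axis (h j) 1)) $ h i"
      using kh[OF ij(1)] by (simp add: E_def)
    also have "\<dots> = kron i j"
    proof -
      have "h i = h j \<longleftrightarrow> i = j" using kh[OF ij(1)] kh[OF ij(2)] by metis
      then show ?thesis unfolding G by (simp add: axis_def kron_def)
    qed
    finally show "\<theta> y i (G (axis (h j) 1)) = kron i j" .
  qed
qed

text \<open>By orthonormality \<open>e\<^sup>l\<close> is the metric product with
  \<open>F l\<close>, so its value on Ju is \<omega>(u, F l), read off from the normal form of
  \<omega>.\<close>

lemma coframe_J:
  assumes y: "y \<in> W" and l: "l \<in> {1..6}"
  shows "\<theta> y l (J c y u) = (if odd l then - \<theta> y (l + 1) u else \<theta> y (l - 1) u)"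
proof -
  obtain F where F: "\<And>i j. i \<in> {1..6} \<Longrightarrow> j \<in> {1..6} \<Longrightarrow> \<theta> y i (F j) = kron i j"
    using dual_frame_exists[OF y] by blast
  have "\<theta> y l (J c y u) = g c y [J c y u, F l]"
    using l by (simp add: metric_coframe[OF y] F kron_def if_distrib cong: if_cong)
  also have "\<dots> = sympl (\<theta> y) u (F l)"
    using fundamental_form_coframe[OF y, of u "F l"] by (simp add: fundamental_form_def)
  also have "\<dots> = (if odd l then - \<theta> y (l + 1) u else \<theta> y (l - 1) u)"
    using l unfolding in_1_6_iff
    by (elim disjE) (simp_all add: sympl_def F kron_def One_nat_def[symmetric])
  finally show ?thesis .
qed

end

text \<open>Duality is required at the point \<open>x\<close> only, while the coframe lives on the
  neighbourhood \<open>W\<close>: the values on \<open>F\<close> are normalised at \<open>x\<close>,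
  and their derivatives carry the torsion.\<close>

locale su3_frame = su3_coframe g c U J \<psi> W e
  for g :: "('a, 6, real) tensor" and c :: "('a, 6) chart" and U :: "(real^6) set"
    and J :: "('a, 6) endo_field" and \<psi> :: "('a, 6, complex) tensor"
    and W :: "(real^6) set" and e :: "nat \<Rightarrow> real^6 \<Rightarrow> (real^6) list \<Rightarrow> real" +
  fixes x :: "real^6" and F :: "nat \<Rightarrow> real^6"
  assumes x_W: "x \<in> W"
    and dual: "i \<in> {1..6} \<Longrightarrow> j \<in> {1..6} \<Longrightarrow> \<theta> x i (F j) = kron i j"
begin

lemma x_U: "x \<in> U"
  using x_W in_U by blast

lemma frame_expansion: "v = (\<Sum>j=1..6. \<theta> x j v *\<^sub>R F j)"
proof -
  have "v - (\<Sum>j=1..6. \<theta> x j v *\<^sub>R F j) = 0"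
  proof (rule coframe_eq_zero[OF x_W])
    fix i :: nat assume i: "i \<in> {1..6}"
    note lin = coframe_linear[OF i x_W]
    have "\<theta> x i (\<Sum>j=1..6. \<theta> x j v *\<^sub>R F j) = (\<Sum>j=1..6. \<theta> x j v * kron i j)"
      by (simp add: linear_sum[OF lin] linear_scale[OF lin] dual[OF i])
    also have "\<dots> = \<theta> x i v" using i by (simp add: kron_def if_distrib cong: if_cong)
    finally show "\<theta> x i (v - (\<Sum>j=1..6. \<theta> x j v *\<^sub>R F j)) = 0"
      by (simp add: linear_diff[OF lin])
  qed
  then show ?thesis by simp
qed

lemma linear_frame:
  fixes f :: "real^6 \<Rightarrow> 'b::real_vector"
  assumes "linear f"
  shows "f v = (\<Sum>j=1..6. \<theta> x j v *\<^sub>R f (F j))"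
  by (subst frame_expansion[of v]) (simp only: linear_sum[OF assms] linear_scale[OF assms])

lemma linear_frame_eq:
  fixes f h :: "real^6 \<Rightarrow> 'b::real_vector"
  assumes "linear f" "linear h" "\<And>j. j \<in> {1..6} \<Longrightarrow> f (F j) = h (F j)"
  shows "f v = h v"
  using linear_frame[OF assms(1), of v] linear_frame[OF assms(2), of v] assms(3) by simp

definition d\<theta> :: "real^6 \<Rightarrow> nat \<Rightarrow> real^6 \<Rightarrow> real" where
  "d\<theta> k i v = frechet_derivative (\<lambda>y. \<theta> y i v) (at x) k"

text \<open>The Levi-Civita derivative of the 1-form \<open>e\<^sup>i\<close> in direction
  \<open>k\<close>; on the dual frame, the connection matrix up to sign convention.\<close>

definition nabla :: "real^6 \<Rightarrow> nat \<Rightarrow> real^6 \<Rightarrow> real" where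
  "nabla k i v = d\<theta> k i v - \<theta> x i (\<Gamma> x k v)"

lemma d\<theta>: "i \<in> {1..6} \<Longrightarrow> ((\<lambda>y. \<theta> y i v) has_derivative (\<lambda>k. d\<theta> k i v)) (at x)"
  unfolding d\<theta>_def using coframe_diff[OF _ x_W] frechet_derivative_works by blast

lemma d\<theta>_linear:
  assumes i: "i \<in> {1..6}"
  shows "linear (\<lambda>k. d\<theta> k i v)" "linear (\<lambda>v. d\<theta> k i v)"
  unfolding d\<theta>_def using i
  by (auto intro!: linear_frechet_derivative coframe_diff x_W frechet_derivative_linear_family[OF open_W x_W] coframe_linear)

lemma nabla_linear:
  assumes i: "i \<in> {1..6}"
  shows "linear (\<lambda>k. nabla k i v)" "linear (\<lambda>v. nabla k i v)"
  unfolding nabla_def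
  by (intro linear_compose_sub d\<theta>_linear i
      linear_compose[OF christoffel_map_linear(1) coframe_linear[OF i x_W], unfolded o_def]
      linear_compose[OF christoffel_map_linear(2) coframe_linear[OF i x_W], unfolded o_def])+

text \<open>Differentiate the metric written as the sum of squares of the coframe, and subtract
  metric compatibility.\<close>

lemma nabla_skew:
  assumes i: "i \<in> {1..6}" and j: "j \<in> {1..6}"
  shows "nabla k i (F j) = - nabla k j (F i)"
proof -
  have "((\<lambda>y. \<Sum>i=1..6. \<theta> y i u * \<theta> y i v) has_derivative
      (\<lambda>k. \<Sum>i=1..6. \<theta> x i u * d\<theta> k i v + d\<theta> k i u * \<theta> x i v)) (at x)" for u v
    by (intro has_derivative_sum has_derivative_mult d\<theta>) auto
  then have "((\<lambda>y. g c y [u, v]) has_derivative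
      (\<lambda>k. \<Sum>i=1..6. \<theta> x i u * d\<theta> k i v + d\<theta> k i u * \<theta> x i v)) (at x)" for u v
    by (rule has_derivative_transform_within_open[OF _ open_W x_W]) (simp add: metric_coframe)
  from frechet_derivative_eqI[OF this]
  have "(\<Sum>i=1..6. \<theta> x i u * d\<theta> k i v + d\<theta> k i u * \<theta> x i v) = g c x [\<Gamma> x k u, v] + g c x [u, \<Gamma> x k v]" for u v
    using metric_compatible[OF x_U, of u v k] by metis
  then have "(\<Sum>i=1..6. \<theta> x i u * nabla k i v + nabla k i u * \<theta> x i v) = 0" for u v
    unfolding nabla_def metric_coframe[OF x_W]
    by (simp add: algebra_simps sum.distrib sum_subtractf)
  from this[of "F i" "F j"] show ?thesis
    using i j by (simp add: dual kron_def sum.distrib if_distrib if_distribR cong: if_cong)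
qed

lemma frechet_derivative_fundamental_form:
  "frechet_derivative (\<lambda>y. fundamental_form g J c y [u, v]) (at x) k = dsympl (\<theta> x) (d\<theta> k) u v"
proof -
  have "((\<lambda>y. sympl (\<theta> y) u v) has_derivative (\<lambda>k. dsympl (\<theta> x) (d\<theta> k) u v)) (at x)"
    unfolding sympl_def dsympl_def by (auto intro!: derivative_eq_intros d\<theta> simp: algebra_simps)
  then have "((\<lambda>y. fundamental_form g J c y [u, v]) has_derivative (\<lambda>k. dsympl (\<theta> x) (d\<theta> k) u v)) (at x)"
    by (rule has_derivative_transform_within_open[OF _ open_W x_W]) (simp add: fundamental_form_coframe)
  then show ?thesis by (simp add: frechet_derivative_eqI)
qed

lemma volume_form_has_derivative:
  "((\<lambda>y. \<psi> c y [u, v, w]) has_derivative (\<lambda>k. dvolf (\<theta> x) (d\<theta> k) u v w)) (at x)"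
proof -
  have z: "((\<lambda>y. zeta (\<theta> y) 1 v) has_derivative (\<lambda>k. zeta (d\<theta> k) 1 v)) (at x)"
    "((\<lambda>y. zeta (\<theta> y) 2 v) has_derivative (\<lambda>k. zeta (d\<theta> k) 2 v)) (at x)"
    "((\<lambda>y. zeta (\<theta> y) 3 v) has_derivative (\<lambda>k. zeta (d\<theta> k) 3 v)) (at x)" for v
    unfolding zeta_numeral by (intro has_derivative_Complex d\<theta>; simp)+
  have "((\<lambda>y. volf (\<theta> y) u v w) has_derivative (\<lambda>k. dvolf (\<theta> x) (d\<theta> k) u v w)) (at x)"
    unfolding volf_def dvolf_def det3_def
    by (rule derivative_eq_intros z refl)+ (simp add: algebra_simps)
  then show ?thesis
    by (rule has_derivative_transform_within_open[OF _ open_W x_W]) (simp add: volume_form_coframe)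
qed

lemma cov_deriv_fundamental_form:
  "cov_deriv g (fundamental_form g J) c x k [u, v] = dsympl (\<theta> x) (nabla k) u v"
  unfolding cov_deriv_def frechet_derivative_fundamental_form
  by (simp add: endo_act_2_form fundamental_form_coframe[OF x_W] sympl_def dsympl_def nabla_def algebra_simps)

lemma cov_deriv_volume_form:
  "cov_deriv g \<psi> c x k [u, v, w] = dvolf (\<theta> x) (nabla k) u v w"
proof -
  have z: "zeta (nabla k) m v = zeta (d\<theta> k) m v - zeta (\<theta> x) m (\<Gamma> x k v)" for m v
    by (simp add: zeta_def nabla_def complex_eq_iff)
  have "cov_deriv g \<psi> c x k [u, v, w] = dvolf (\<theta> x) (d\<theta> k) u v w
    - (volf (\<theta> x) (\<Gamma> x k u) v w + volf (\<theta> x) u (\<Gamma> x k v) w + volf (\<theta> x) u v (\<Gamma> x k w))"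
    unfolding cov_deriv_def
    by (simp add: frechet_derivative_eqI[OF volume_form_has_derivative] endo_act_3_form volume_form_coframe[OF x_W])
  then show ?thesis
    by (simp add: volf_def dvolf_def det3_def z algebra_simps)
qed

lemma dsympl_frame:
  "a \<in> {1..6} \<Longrightarrow> b \<in> {1..6} \<Longrightarrow> dsympl (\<theta> x) p (F a) (F b) = dsympl kron (\<lambda>i j. p i (F j)) a b"
  by (simp add: dsympl_def dual)

lemma zeta_frame:
  assumes "a \<in> {1..6}"
  shows "zeta (\<theta> x) 1 (F a) = zeta kron 1 a" "zeta (\<theta> x) 2 (F a) = zeta kron 2 a" "zeta (\<theta> x) 3 (F a) = zeta kron 3 a"
  using assms by (simp_all add: zeta_numeral dual)

lemma dvolf_frame:
  "a \<in> {1..6} \<Longrightarrow> b \<in> {1..6} \<Longrightarrow> d \<in> {1..6} \<Longrightarrow>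
    dvolf (\<theta> x) p (F a) (F b) (F d) = dvolf kron (\<lambda>i j. p i (F j)) a b d"
  by (simp add: dvolf_def det3_def zeta_frame) (simp add: zeta_def)

abbreviation B where "B k i j \<equiv> d\<theta> (F k) i (F j)"
abbreviation A where "A k i j \<equiv> nabla (F k) i (F j)"

lemma alt_dsympl_B: "alt_dsympl B a b d = alt_dsympl A a b d"
  by (rule alt_dsympl_symmetric_part[where G = "\<lambda>i k j. \<theta> x i (\<Gamma> x (F k) (F j))"])
    (simp_all add: nabla_def christoffel_map_sym[OF x_U])

lemma alt_dvolf_B: "alt_dvolf B a b d f = alt_dvolf A a b d f"
  by (rule alt_dvolf_symmetric_part[where G = "\<lambda>i k j. \<theta> x i (\<Gamma> x (F k) (F j))"])
    (simp_all add: nabla_def christoffel_map_sym[OF x_U])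

lemma ext_deriv_fundamental_form:
  assumes "a \<in> {1..6}" "b \<in> {1..6}" "d \<in> {1..6}"
  shows "ext_deriv (fundamental_form g J) c x [F a, F b, F d] = alt_dsympl B a b d"
  using assms
  by (simp add: ext_deriv_2_form frechet_derivative_fundamental_form dsympl_frame alt_dsympl_def)

lemma ext_deriv_volume_form:
  assumes "a \<in> {1..6}" "b \<in> {1..6}" "d \<in> {1..6}" "f \<in> {1..6}"
  shows "ext_deriv \<psi> c x [F a, F b, F d, F f] = alt_dvolf B a b d f"
  using assms
  by (simp add: ext_deriv_3_form frechet_derivative_eqI[OF volume_form_has_derivative] dvolf_frame alt_dvolf_def)

lemma ext_deriv_re_im_part:
  assumes "length vs = 4"
  shows "ext_deriv (re_part \<psi>) c x vs = Re (ext_deriv \<psi> c x vs)"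
    "ext_deriv (im_part \<psi>) c x vs = Im (ext_deriv \<psi> c x vs)"
proof -
  obtain u v w z where vs: "vs = [u, v, w, z]" using assms by (auto simp: length_eq_numeral)
  have *: "frechet_derivative (\<lambda>y. re_part \<psi> c y us) (at x) = (\<lambda>k. Re (frechet_derivative (\<lambda>y. \<psi> c y us) (at x) k))"
    "frechet_derivative (\<lambda>y. im_part \<psi> c y us) (at x) = (\<lambda>k. Im (frechet_derivative (\<lambda>y. \<psi> c y us) (at x) k))"
    if len: "length us = 3" for us
  proof -
    obtain u v w where us: "us = [u, v, w]" using len by (auto simp: length_eq_numeral)
    note D = volume_form_has_derivative[of u v w, folded us]
    show "frechet_derivative (\<lambda>y. re_part \<psi> c y us) (at x) = (\<lambda>k. Re (frechet_derivative (\<lambda>y. \<psi> c y us) (at x) k))"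
      unfolding re_part_def frechet_derivative_eqI[OF D]
      by (intro frechet_derivative_eqI has_derivative_Re D)
    show "frechet_derivative (\<lambda>y. im_part \<psi> c y us) (at x) = (\<lambda>k. Im (frechet_derivative (\<lambda>y. \<psi> c y us) (at x) k))"
      unfolding im_part_def frechet_derivative_eqI[OF D]
      by (intro frechet_derivative_eqI has_derivative_Im D)
  qed
  show "ext_deriv (re_part \<psi>) c x vs = Re (ext_deriv \<psi> c x vs)"
    "ext_deriv (im_part \<psi>) c x vs = Im (ext_deriv \<psi> c x vs)"
    by (simp_all add: vs ext_deriv_3_form *)
qed

end

section \<open>Linearity and trace formulas for the differentiated forms\<close>

lemma jidx_in: "a \<in> {1..6} \<Longrightarrow> jidx a \<in> {1..6}"
  unfolding in_1_6_iff by (elim disjE) (simp_all add: jidx_def One_nat_def[symmetric])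

lemma linear_Complex: "linear f \<Longrightarrow> linear h \<Longrightarrow> linear (\<lambda>v. Complex (f v) (h v))"
  by (rule linearI) (simp_all add: linear_add linear_scale complex_eq_iff)

lemma dsympl_linear:
  assumes "\<And>i. i \<in> {1..6} \<Longrightarrow> linear (p i)" "\<And>i. i \<in> {1..6} \<Longrightarrow> linear (p' i)"
  shows "linear (\<lambda>u. dsympl p p' u v)" "linear (\<lambda>v. dsympl p p' u v)"
  by (rule linearI; simp add: dsympl_def linear_add[OF assms(1)] linear_add[OF assms(2)]
      linear_scale[OF assms(1)] linear_scale[OF assms(2)] algebra_simps)+

lemma dsympl_linear_family:
  assumes "\<And>i v. i \<in> {1..6} \<Longrightarrow> linear (\<lambda>k. p' k i v)"
  shows "linear (\<lambda>k. dsympl p (p' k) u v)"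
  by (rule linearI; simp add: dsympl_def linear_add[OF assms] linear_scale[OF assms] algebra_simps)

lemma dvolf_linear_family:
  assumes "\<And>i v. i \<in> {1..6} \<Longrightarrow> linear (\<lambda>k. p' k i v)"
  shows "linear (\<lambda>k. dvolf p (p' k) u v w)"
proof -
  have z: "zeta (p' (k + l)) m v = zeta (p' k) m v + zeta (p' l) m v"
    "zeta (p' (r *\<^sub>R k)) m v = r *\<^sub>R zeta (p' k) m v" if "m = 1 \<or> m = 2 \<or> m = 3" for k l m v and r :: real
    using that by (auto simp: zeta_numeral linear_add[OF assms] linear_scale[OF assms] complex_eq_iff)
  show ?thesis
    by (rule linearI; simp add: dvolf_def det3_def z algebra_simps scaleR_conv_of_real)
qed

text \<open>A complex-linear endomorphism \<kappa> acts on the complex volume form by multiplication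
  with its trace.\<close>

lemma dvolf_trace_free:
  assumes \<kappa>: "\<And>m v. m = 1 \<or> m = 2 \<or> m = 3 \<Longrightarrow>
      zeta p' m v = \<kappa> m 1 * zeta p 1 v + \<kappa> m 2 * zeta p 2 v + \<kappa> m 3 * zeta p 3 v"
    and tr: "\<kappa> 1 1 + \<kappa> 2 2 + \<kappa> 3 (3::nat) = 0"
  shows "dvolf p p' u v w = 0"
proof -
  have "dvolf p p' u v w = (\<kappa> 1 1 + \<kappa> 2 2 + \<kappa> 3 3) * volf p u v w"
    by (simp add: dvolf_def volf_def det3_def \<kappa> algebra_simps)
  then show ?thesis by (simp add: tr)
qed

section \<open>Vanishing of the torsion form, parallelism and Ricci curvature at the point\<close>

context su3_frame
begin

lemma J_frame:
  assumes a: "a \<in> {1..6}"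
  shows "J c x (F a) = jsgn a *\<^sub>R F (jidx a)"
proof -
  have "J c x (F a) - jsgn a *\<^sub>R F (jidx a) = 0"
  proof (rule coframe_eq_zero[OF x_W])
    fix i :: nat assume i: "i \<in> {1..6}"
    have "\<theta> x i (J c x (F a)) = jsgn a * kron i (jidx a)"
      using i a unfolding coframe_J[OF x_W i] in_1_6_iff
      by (elim disjE) (simp_all add: dual kron_def jsgn_def jidx_def One_nat_def[symmetric])
    then show "\<theta> x i (J c x (F a) - jsgn a *\<^sub>R F (jidx a)) = 0"
      using dual[OF i jidx_in[OF a]]
      by (simp add: linear_diff[OF coframe_linear[OF i x_W]] linear_scale[OF coframe_linear[OF i x_W]])
  qed
  then show ?thesis by simp
qed

text \<open>Translates the forms at \<open>x\<close> into the arrays of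
  \<open>torsion_form_algebra\<close>. Type and skewness of \<pi> are assumed on all of
  \<open>U\<close> because they are differentiated.\<close>

lemma torsion_form_eq_zero:
  fixes \<pi> :: "('a, 6, real) tensor"
  assumes J_diff: "\<And>v. (\<lambda>y. J c y v) differentiable (at x)"
    and \<pi>_multilinear: "\<And>y. y \<in> U \<Longrightarrow> multilinear_form 2 (\<pi> c y)"
    and \<pi>_skew: "\<And>y u v. y \<in> U \<Longrightarrow> \<pi> c y [u, v] = - \<pi> c y [v, u]"
    and \<pi>_diff: "\<And>u v. (\<lambda>y. \<pi> c y [u, v]) differentiable (at x)"
    and \<pi>_J: "\<And>y u v. y \<in> U \<Longrightarrow> \<pi> c y [J c y u, J c y v] = \<pi> c y [u, v]"
    and d\<pi>: "\<And>u v w. ext_deriv \<pi> c x [u, v, w] = 0"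
    and d\<omega>: "\<And>u v w. ext_deriv (fundamental_form g J) c x [u, v, w] = 0"
    and d\<psi>_re: "\<And>u v w z. ext_deriv (re_part \<psi>) c x [u, v, w, z]
      = - wedge 2 2 (\<pi> c x) (fundamental_form g J c x) [u, v, w, z]"
    and d\<psi>_im: "\<And>u v w z. ext_deriv (im_part \<psi>) c x [u, v, w, z] = 0"
  shows "\<pi> c x [u, v] = 0"
proof -
  note \<pi>_lin = multilinear_form_2[OF \<pi>_multilinear]
  define q where "q a b = \<pi> c x [F a, F b]" for a b
  define M where "M k a b = frechet_derivative (\<lambda>y. \<pi> c y [F a, F b]) (at x) (F k)" for k a b
  define K where "K k u = frechet_derivative (\<lambda>y. J c y u) (at x) k" for k u
  have K: "((\<lambda>y. J c y u) has_derivative (\<lambda>k. K k u)) (at x)" for u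
    unfolding K_def using J_diff frechet_derivative_works by blast
  \<comment> \<open>The function \<open>e\<^sup>l (J F a)\<close> is differentiated in two ways: by
    the product rule, and after rewriting it by \<open>coframe_J\<close> as a single signed coframe
    component.\<close>
  have K_dJ: "\<theta> x l (K (F k) (F a)) = dJ B k l a" if l: "l \<in> {1..6}" and a: "a \<in> {1..6}" for l k a
  proof -
    have "((\<lambda>y. \<theta> y l (J c y (F a))) has_derivative
        (\<lambda>w. frechet_derivative (\<lambda>y. \<theta> y l (J c x (F a))) (at x) w + \<theta> x l (K w (F a)))) (at x)"
      by (rule has_derivative_linear_family[OF open_W x_W coframe_linear[OF l] coframe_diff[OF l x_W] K])
    then have "frechet_derivative (\<lambda>y. \<theta> y l (J c y (F a))) (at x) (F k)
        = d\<theta> (F k) l (J c x (F a)) + \<theta> x l (K (F k) (F a))"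
      by (simp add: frechet_derivative_eqI d\<theta>_def)
    moreover have "frechet_derivative (\<lambda>y. \<theta> y l (J c y (F a))) (at x) (F k)
        = (if odd l then - B k (l + 1) a else B k (l - 1) a)"
    proof -
      have l': "odd l \<Longrightarrow> l + 1 \<in> {1..6}" "even l \<Longrightarrow> l - 1 \<in> {1..6}" using l unfolding in_1_6_iff by auto
      have "frechet_derivative (\<lambda>y. \<theta> y l (J c y (F a))) (at x) (F k)
        = frechet_derivative (\<lambda>y. if odd l then - \<theta> y (l + 1) (F a) else \<theta> y (l - 1) (F a)) (at x) (F k)"
        by (rule fun_cong[OF frechet_derivative_cong_open[OF open_W x_W]]) (rule coframe_J[OF _ l])
      also have "\<dots> = (if odd l then - B k (l + 1) a else B k (l - 1) a)"
    using frechet_derivative_eqI[OF has_derivative_minus[OF d\<theta>[OF l'(1)]]] frechet_derivative_eqI[OF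
      d\<theta>[OF l'(2)]]
        by simp
      finally show ?thesis .
    qed
    moreover have "d\<theta> (F k) l (J c x (F a)) = jsgn a * B k l (jidx a)"
      by (simp add: J_frame[OF a] linear_scale[OF d\<theta>_linear(2)[OF l]])
    ultimately show ?thesis by (simp add: dJ_def)
  qed
  have \<pi>_K: "\<pi> c x [K (F k) (F a), F b] = (\<Sum>l=1..6. dJ B k l a * q l b)"
    "\<pi> c x [F b, K (F k) (F a)] = (\<Sum>l=1..6. dJ B k l a * q b l)" if "a \<in> {1..6}" for k a b
    using linear_frame[OF \<pi>_lin(1)[OF x_U], of "K (F k) (F a)" "F b"]
      linear_frame[OF \<pi>_lin(2)[OF x_U], of "F b" "K (F k) (F a)"] that
    by (simp_all add: q_def K_dJ)
  have \<pi>_scale: "\<pi> c y [r *\<^sub>R u, v] = r * \<pi> c y [u, v]" "\<pi> c y [u, r *\<^sub>R v] = r * \<pi> c y [u, v]"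
    if "y \<in> U" for y u v r
    using linear_scale[OF \<pi>_lin(1)[OF that]] linear_scale[OF \<pi>_lin(2)[OF that]] by simp_all
  have "q a b = 0" if "a \<in> {1..6}" "b \<in> {1..6}" for a b
  proof (rule torsion_form_algebra[where q = q and M = M and B = B])
    show "q a b = - q b a" for a b unfolding q_def by (rule \<pi>_skew[OF x_U])
    show "M k a b = - M k b a" for k a b
    proof -
      have "frechet_derivative (\<lambda>y. \<pi> c y [F a, F b]) (at x) = frechet_derivative (\<lambda>y. - \<pi> c y [F b, F a]) (at x)"
        by (rule frechet_derivative_cong_open[OF open_U x_U]) (rule \<pi>_skew)
      also have "\<dots> = (\<lambda>k. - frechet_derivative (\<lambda>y. \<pi> c y [F b, F a]) (at x) k)"
        using \<pi>_diff[unfolded frechet_derivative_works] by (intro frechet_derivative_eqI has_derivative_minus)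
      finally show ?thesis by (simp add: M_def)
    qed
    show "jsgn a * jsgn b * q (jidx a) (jidx b) = q a b" if "a \<in> {1..6}" "b \<in> {1..6}" for a b
      using \<pi>_J[OF x_U, of "F a" "F b"] that by (simp add: J_frame \<pi>_scale[OF x_U] q_def mult_ac)
    show "jsgn a * jsgn b * M k (jidx a) (jidx b)
      + (\<Sum>l=1..6. dJ B k l a * jsgn b * q l (jidx b)) + (\<Sum>l=1..6. dJ B k l b * jsgn a * q (jidx a) l) = M k a b"
      if k: "k \<in> {1..6}" and a: "a \<in> {1..6}" and b: "b \<in> {1..6}" for k a b
    proof -
      let ?u = "J c x (F a)" and ?v = "J c x (F b)"
      \<comment> \<open>Product rule for \<pi>(J F a, J F b), one slot at a time: here the second
        argument is frozen, next the first slot is part of the linear family.\<close>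
      have D1: "((\<lambda>y. \<pi> c y [J c y (F a), w]) has_derivative
          (\<lambda>k. frechet_derivative (\<lambda>y. \<pi> c y [?u, w]) (at x) k + \<pi> c x [K k (F a), w])) (at x)" for w
        by (rule has_derivative_linear_family[OF open_U x_U, of "\<lambda>y z. \<pi> c y [z, w]"]) (auto intro: \<pi>_lin \<pi>_diff K)
      have "((\<lambda>y. \<pi> c y [J c y (F a), J c y (F b)]) has_derivative
          (\<lambda>k. frechet_derivative (\<lambda>y. \<pi> c y [J c y (F a), ?v]) (at x) k + \<pi> c x [?u, K k (F b)])) (at x)"
        by (rule has_derivative_linear_family[OF open_U x_U, of "\<lambda>y z. \<pi> c y [J c y (F a), z]"])
          (auto intro: \<pi>_lin K differentiableI[OF D1])
      then have "((\<lambda>y. \<pi> c y [F a, F b]) has_derivative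
          (\<lambda>k. frechet_derivative (\<lambda>y. \<pi> c y [J c y (F a), ?v]) (at x) k + \<pi> c x [?u, K k (F b)])) (at x)"
        by (rule has_derivative_transform_within_open[OF _ open_U x_U]) (rule \<pi>_J)
      then have eq: "M k a b = frechet_derivative (\<lambda>y. \<pi> c y [?u, ?v]) (at x) (F k) + \<pi> c x [K (F k) (F a), ?v]
          + \<pi> c x [?u, K (F k) (F b)]"
        unfolding M_def by (simp add: frechet_derivative_eqI frechet_derivative_eqI[OF D1])
      have "frechet_derivative (\<lambda>y. \<pi> c y [?u, ?v]) (at x) (F k)
        = frechet_derivative (\<lambda>y. (jsgn a * jsgn b) * \<pi> c y [F (jidx a), F (jidx b)]) (at x) (F k)"
        by (rule fun_cong[OF frechet_derivative_cong_open[OF open_U x_U]]) (simp add: J_frame[OF a] J_frame[OF b] \<pi>_scale)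
      also have "\<dots> = jsgn a * jsgn b * M k (jidx a) (jidx b)"
        using frechet_derivative_eqI[OF has_derivative_mult_right[OF \<pi>_diff[unfolded frechet_derivative_works]]]
        by (simp add: M_def)
      finally show ?thesis
        unfolding eq by (simp add: J_frame[OF a] J_frame[OF b] \<pi>_scale[OF x_U] \<pi>_K[OF a] \<pi>_K[OF b] sum_distrib_left mult_ac)
    qed
    show "M a b d - M b a d + M d a b = 0" for a b d
      using d\<pi>[of "F a" "F b" "F d"] by (simp add: ext_deriv_2_form M_def)
    show "alt_dsympl B a b d = 0" if "a \<in> {1..6}" "b \<in> {1..6}" "d \<in> {1..6}" for a b d
      using d\<omega>[of "F a" "F b" "F d"] ext_deriv_fundamental_form[OF that] by simp
    show "alt_dvolf B a b d f = - of_real (wedge_sympl q a b d f)"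
      if "a \<in> {1..6}" "b \<in> {1..6}" "d \<in> {1..6}" "f \<in> {1..6}" for a b d f
    proof -
      have s: "sympl (\<theta> x) (F i) (F j) = sympl kron i j" if "i \<in> {1..6}" "j \<in> {1..6}" for i j
        using that by (simp add: sympl_def dual)
      have "wedge 2 2 (\<pi> c x) (fundamental_form g J c x) [F a, F b, F d, F f] = wedge_sympl q a b d f"
        using that sympl_skew
        by (subst wedge_2_2) (auto simp: fundamental_form_coframe[OF x_W] wedge_sympl_def q_def s intro: \<pi>_skew[OF x_U])
      then show ?thesis
        using ext_deriv_volume_form[OF that] d\<psi>_re[of "F a" "F b" "F d" "F f"] d\<psi>_im[of "F a" "F b" "F d" "F f"]
          ext_deriv_re_im_part[of "[F a, F b, F d, F f]"]
        by (simp add: complex_eq_iff)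
    qed
  qed (use that in auto)
  then have "\<pi> c x [F a, v] = 0" if "a \<in> {1..6}" for a
    using that linear_frame[OF \<pi>_lin(2)[OF x_U], of "F a" v] by (simp add: q_def)
  then show ?thesis
    using linear_frame[OF \<pi>_lin(1)[OF x_U], of u v] by simp
qed

text \<open>Closedness puts each matrix \<open>A j\<close> into \<open>su(3)\<close>, whose elements
  annihilate \<omega> and \<psi>; linearity carries this from frame vectors to all vectors and
  directions.\<close>

lemma parallel_of_closed:
  assumes d\<omega>: "\<And>u v w. ext_deriv (fundamental_form g J) c x [u, v, w] = 0"
    and d\<psi>: "\<And>u v w z. ext_deriv \<psi> c x [u, v, w, z] = 0"
  shows "cov_deriv g (fundamental_form g J) c x k [u, v] = 0"
    and "cov_deriv g \<psi> c x k [u, v, w] = 0"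
proof -
  have rel: "A j 1 3 = A j 2 4 \<and> A j 1 4 = - A j 2 3 \<and> A j 1 5 = A j 2 6 \<and> A j 1 6 = - A j 2 5 \<and>
    A j 3 5 = A j 4 6 \<and> A j 3 6 = - A j 4 5 \<and> A j 1 2 + A j 3 4 + A j 5 6 = 0" if "j \<in> {1..6}" for j
  proof (rule torsion_algebra[where A = A, OF nabla_skew _ _ that])
    show "alt_dsympl A a b d = 0" if "a \<in> {1..6}" "b \<in> {1..6}" "d \<in> {1..6}" for a b d
      unfolding alt_dsympl_B[symmetric] ext_deriv_fundamental_form[OF that, symmetric] by (rule d\<omega>)
    show "alt_dvolf A a b d f = 0" if "a \<in> {1..6}" "b \<in> {1..6}" "d \<in> {1..6}" "f \<in> {1..6}" for a b d f
      unfolding alt_dvolf_B[symmetric] ext_deriv_volume_form[OF that, symmetric] by (rule d\<psi>)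
  qed
  have skew: "A j b a = - A j a b" if "a < b" "1 \<le> a" "b \<le> 6" for j a b
    using nabla_skew[of b a "F j"] that by simp
  have A0: "A j a a = 0" if "1 \<le> a" "a \<le> 6" for j a
    using nabla_skew[of a a "F j"] that by simp
  have "dsympl (\<theta> x) (nabla (F j)) u v = 0" if j: "j \<in> {1..6}" for j
  proof -
    have lin: "linear (\<lambda>u. dsympl (\<theta> x) (nabla (F j)) u v)" "linear (\<lambda>v. dsympl (\<theta> x) (nabla (F j)) u v)" for u v
      by (intro dsympl_linear coframe_linear x_W nabla_linear; assumption)+
    have "dsympl (\<theta> x) (nabla (F j)) (F a) (F b) = 0" if ab: "a \<in> {1..6}" "b \<in> {1..6}" for a b
      unfolding dsympl_frame[OF ab] using ab rel[OF j] unfolding in_1_6_iff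
      by (elim disjE) (simp_all add: dsympl_def kron_def skew A0)
    then have "dsympl (\<theta> x) (nabla (F j)) (F a) v = 0" if "a \<in> {1..6}" for a
      using linear_frame[OF lin(2), of "F a" v] that by simp
    then show ?thesis
      using linear_frame[OF lin(1), of u v] by simp
  qed
  then show "cov_deriv g (fundamental_form g J) c x k [u, v] = 0"
    unfolding cov_deriv_fundamental_form
    using linear_frame[OF dsympl_linear_family[of nabla "\<theta> x" u v], OF nabla_linear(1), of k] by simp
  \<comment> \<open>Commuting with J makes \<open>nabla (F j)\<close> a complex 3 by 3 matrix. Its
    columns are the values on \<open>F 1\<close>, \<open>F 3\<close>, \<open>F 5\<close>, where the
    complex coframe is the identity.\<close>
  have "dvolf (\<theta> x) (nabla (F j)) u v w = 0" if j: "j \<in> {1..6}" for j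
  proof (rule dvolf_trace_free[where \<kappa> = "\<lambda>m n. zeta (nabla (F j)) m (F (2 * n - 1))"])
    fix m :: nat and v assume m: "m = 1 \<or> m = 2 \<or> m = 3"
    have lin: "linear (zeta (nabla (F j)) m)"
    using m unfolding zeta_numeral[abs_def] by (elim disjE) (simp_all add: zeta_numeral[abs_def] linear_Complex
      nabla_linear)
    have lin': "linear (\<lambda>v. a * zeta (\<theta> x) 1 v + b * zeta (\<theta> x) 2 v + d * zeta (\<theta> x) 3 v)" for a b d :: complex
      by (rule linearI) (simp_all add: zeta_numeral linear_add[OF coframe_linear[OF _ x_W]]
          linear_scale[OF coframe_linear[OF _ x_W]] complex_eq_iff algebra_simps)
    show "zeta (nabla (F j)) m v = zeta (nabla (F j)) m (F (2 * 1 - 1)) * zeta (\<theta> x) 1 v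
      + zeta (nabla (F j)) m (F (2 * 2 - 1)) * zeta (\<theta> x) 2 v + zeta (nabla (F j)) m (F (2 * 3 - 1)) * zeta (\<theta> x) 3 v"
    proof (rule linear_frame_eq[OF lin lin'])
      fix i :: nat assume i: "i \<in> {1..6}"
      show "zeta (nabla (F j)) m (F i) = zeta (nabla (F j)) m (F (2 * 1 - 1)) * zeta (\<theta> x) 1 (F i)
      + zeta (nabla (F j)) m (F (2 * 2 - 1)) * zeta (\<theta> x) 2 (F i) + zeta (nabla (F j)) m (F (2 * 3 - 1)) * zeta (\<theta> x) 3 (F i)"
        using m i rel[OF j] unfolding zeta_frame[OF i] unfolding in_1_6_iff
        by (elim disjE) (simp_all add: zeta_numeral kron_def skew A0 complex_eq_iff One_nat_def[symmetric])
    qed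
  next
    show "zeta (nabla (F j)) 1 (F (2 * 1 - 1)) + zeta (nabla (F j)) 2 (F (2 * 2 - 1))
      + zeta (nabla (F j)) 3 (F (2 * 3 - 1)) = 0"
      using rel[OF j] by (simp add: zeta_numeral skew A0 complex_eq_iff One_nat_def[symmetric])
  qed
  then show "cov_deriv g \<psi> c x k [u, v, w] = 0"
    unfolding cov_deriv_volume_form
    using linear_frame[OF dvolf_linear_family[of nabla "\<theta> x" u v w], OF nabla_linear(1), of k] by simp
qed

text \<open>Curvature kills the parallel tensors \<open>g\<close> and \<psi>, so its values lie in
  \<open>su(3)\<close>. Parallelism is assumed on \<open>U\<close>, since
  \<open>parallel_curvature\<close> differentiates it.\<close>

lemma ricci_eq_zero:
  assumes J_linear: "linear (J c x)" and J_square: "\<And>v. J c x (J c x v) = - v"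
    and \<psi>_multilinear: "\<And>y. y \<in> U \<Longrightarrow> multilinear_form 3 (\<psi> c y)"
    and \<psi>_smooth: "\<And>vs. length vs = 3 \<Longrightarrow> smooth_map_on (\<lambda>y. \<psi> c y vs) U"
    and \<psi>_parallel: "\<And>y u vs. y \<in> U \<Longrightarrow> length vs = 3 \<Longrightarrow> cov_deriv g \<psi> c y u vs = 0"
  shows "ricci g c x j k = 0"
proof -
  let ?R = "curvature g c x"
  define Q where "Q u v w z = g c x [?R u v w, z]" for u v w z
  define r where "r u v i w = \<theta> x i (?R u v w)" for u v i w
  note R_lin = curvature_linear[OF x_U]
  note g_lin = metric_linear[OF x_U]
  have g_frame: "g c x [w, F a] = \<theta> x a w" if "a \<in> {1..6}" for w a
    using that by (simp add: metric_coframe[OF x_W] dual kron_def if_distrib cong: if_cong)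
  have Q_lin: "linear (\<lambda>u. Q u v w z)" "linear (\<lambda>w. Q u v w z)" "linear (\<lambda>z. Q u v w z)" for u v w z
    unfolding Q_def
    using linear_compose[OF R_lin(1) g_lin(1)] linear_compose[OF R_lin(2) g_lin(1)] g_lin(2)
    by (simp_all add: o_def)
  have Q_frame: "Q u v w (F b) = r u v b w" if "b \<in> {1..6}" for u v w b
    by (simp add: Q_def r_def g_frame[OF that])
  have Q_skew: "Q u v w z = - Q u v z w" for u v w z
  proof -
    have "endo_act (?R u v) (g c x) [w, z] = 0"
    proof (rule parallel_curvature[where T = g, OF metric_multilinear metric_smooth _ x_U])
      fix y a and vs :: "(real^6) list" assume y: "y \<in> U" and "length vs = 2"
      then obtain s t where vs: "vs = [s, t]" by (auto simp: length_eq_numeral)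
      show "cov_deriv g g c y a vs = 0"
        by (simp add: vs cov_deriv_def endo_act_2_form metric_compatible[OF y])
    qed auto
    then show ?thesis by (simp add: endo_act_2_form Q_def metric_sym[OF x_U, of w])
  qed
  have r_skew: "r u v a (F b) = - r u v b (F a)" if "a \<in> {1..6}" "b \<in> {1..6}" for u v a b
    using Q_skew[of u v "F b" "F a"] that by (simp add: Q_def r_def g_frame)
  have skew: "r u v b (F a) = - r u v a (F b)" if "a < b" "1 \<le> a" "b \<le> 6" for u v a b
    using r_skew[of b a u v] that by simp
  have r0: "r u v a (F a) = 0" if "1 \<le> a" "a \<le> 6" for u v a
    using r_skew[of a a u v] that by simp
  have vol: "dvolf kron (\<lambda>i j. r u v i (F j)) a b d = 0"
    if abd: "a \<in> {1..6}" "b \<in> {1..6}" "d \<in> {1..6}" for u v a b d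
  proof -
    have "endo_act (?R u v) (\<psi> c x) [F a, F b, F d] = 0"
      by (rule parallel_curvature[where T = \<psi>, OF \<psi>_multilinear \<psi>_smooth \<psi>_parallel x_U]) auto
    then have "dvolf (\<theta> x) (r u v) (F a) (F b) (F d) = 0"
      by (simp add: endo_act_3_form volume_form_coframe[OF x_W] volf_def dvolf_def det3_def zeta_def r_def algebra_simps)
    then show ?thesis by (simp add: dvolf_frame[OF abd])
  qed
  note ev = dvolf_def det3_def zeta_kron zeta_numeral[of "\<lambda>i j. r _ _ i (F j)"] complex_eq_iff skew r0
  \<comment> \<open>The triple 1 3 5 gives the complex trace. A triple containing a complex pair
    such as 1, 2 isolates the failure of one matrix entry to be complex linear, so three such
    triples suffice.\<close>
  have rel: "r u v 1 (F 2) + r u v 3 (F 4) + r u v 5 (F 6) = 0"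
    "r u v 1 (F 3) = r u v 2 (F 4)" "r u v 1 (F 4) = - r u v 2 (F 3)"
    "r u v 1 (F 5) = r u v 2 (F 6)" "r u v 1 (F 6) = - r u v 2 (F 5)"
    "r u v 3 (F 5) = r u v 4 (F 6)" "r u v 3 (F 6) = - r u v 4 (F 5)" for u v
    using vol[of 1 3 5 u v] vol[of 1 2 3 u v] vol[of 1 2 5 u v] vol[of 3 4 1 u v]
    by (simp_all add: ev)
  have QJ: "Q u v (J c x w) (J c x z) = Q u v w z" for u v w z
  proof -
    have lin: "linear (\<lambda>w. Q u v (J c x w) (J c x z))" "linear (\<lambda>z. Q u v (J c x w) (J c x z))" for w z
      using linear_compose[OF J_linear Q_lin(2)] linear_compose[OF J_linear Q_lin(3)] by (simp_all add: o_def)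
    have FF: "Q u v (J c x (F a)) (J c x (F b)) = Q u v (F a) (F b)" if ab: "a \<in> {1..6}" "b \<in> {1..6}" for a b
    proof -
      have "Q u v (J c x (F a)) (J c x (F b)) = jsgn a * jsgn b * Q u v (F (jidx a)) (F (jidx b))"
        by (simp add: J_frame[OF ab(1)] J_frame[OF ab(2)] linear_scale[OF Q_lin(2)] linear_scale[OF Q_lin(3)])
      also have "\<dots> = jsgn a * jsgn b * r u v (jidx b) (F (jidx a))"
        by (simp add: Q_frame[OF jidx_in[OF ab(2)]])
      also have "\<dots> = r u v b (F a)"
        using ab rel[of u v] unfolding in_1_6_iff
        by (elim disjE) (simp_all add: jsgn_def jidx_def skew r0 One_nat_def[symmetric])
      finally show ?thesis by (simp add: Q_frame[OF ab(2)])
    qed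
    have Fz: "Q u v (J c x (F a)) (J c x z) = Q u v (F a) z" if "a \<in> {1..6}" for a
      by (rule linear_frame_eq[OF lin(2) Q_lin(3)]) (rule FF[OF that])
    show ?thesis by (rule linear_frame_eq[OF lin(1) Q_lin(2)]) (rule Fz)
  qed
  have "(\<Sum>a=1..6. Q (F a) v w (F a)) = 0" for v w
  proof (rule su_curvature_trace_eq_zero[where J = "J c x", OF Q_lin(1) Q_lin(3)])
    show "Q u v w z = - Q v u w z" for u v w z
      unfolding Q_def by (subst curvature_antisym) (simp add: linear_neg[OF g_lin(1)])
    show "Q u v w z + Q v w u z + Q w u v z = 0" for u v w z
      unfolding Q_def linear_add[OF g_lin(1), symmetric] curvature_bianchi[OF x_U] by (rule linear_0[OF g_lin(1)])
    show "(\<Sum>a=1..6. Q u v (F a) (J c x (F a))) = 0" for u v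
      using rel(1)[of u v]
      by (simp add: sum_1_6 J_frame jsgn_def jidx_def linear_neg[OF Q_lin(3)] Q_frame skew One_nat_def[symmetric])
    show "J c x (F 1) = F 2" "J c x (F 3) = F 4" "J c x (F 5) = F 6"
      by (simp_all add: J_frame jsgn_def jidx_def One_nat_def[symmetric])
  qed (rule Q_skew QJ J_square)+
  then have tr: "(\<Sum>a=1..6. \<theta> x a (?R (F a) v w)) = 0" for v w
    by (simp add: Q_def g_frame)
  \<comment> \<open>The Ricci tensor is a trace over coordinate axes; the trace of a linear map is
    the same in the frame \<open>F\<close> with its dual coframe.\<close>
  let ?L = "\<lambda>u. ?R u (axis j 1) (axis k 1)"
  have "ricci g c x j k = (\<Sum>i\<in>UNIV. ?L (axis i 1) $ i)"
    by (rule ricci_eq_trace[OF x_U])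
  also have "\<dots> = (\<Sum>i\<in>UNIV. \<Sum>a=1..6. \<theta> x a (axis i 1) * ?L (F a) $ i)"
    by (subst linear_frame[OF R_lin(1)]) simp
  also have "\<dots> = (\<Sum>a=1..6. \<Sum>i\<in>UNIV. \<theta> x a (axis i 1) * ?L (F a) $ i)"
    by (rule sum.swap)
  also have "\<dots> = (\<Sum>a=1..6. \<theta> x a (?L (F a)))"
  proof (rule sum.cong[OF refl])
    fix a :: nat assume "a \<in> {1..6}"
    note lin = coframe_linear[OF this x_W]
    show "(\<Sum>i\<in>UNIV. \<theta> x a (axis i 1) * ?L (F a) $ i) = \<theta> x a (?L (F a))"
      by (subst (2) basis_expansion[of "?L (F a)", symmetric])
        (simp add: linear_sum[OF lin] linear_scale[OF lin] scalar_mult_eq_scaleR mult.commute)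
  qed
  also have "\<dots> = 0" by (rule tr)
  finally show ?thesis .
qed

end

declare One_nat_def [simp]

section \<open>Closed torsion form\<close>

theorem proposition5p2:
  fixes X :: "'a topology"
    and A :: "('a, 6) chart set"
    and g :: "('a, 6, real) tensor"
    and J :: "('a, 6) endo_field"
    and \<psi> :: "('a, 6, complex) tensor"
    and \<pi>\<^sub>2 :: "('a, 6, real) tensor"
  assumes "smooth_manifold X A"
    and "su3_structure A g J \<psi>"
    and "su3_W2_plus A g J \<psi> \<pi>\<^sub>2"
    and "closed_form A 2 \<pi>\<^sub>2"
  shows "su3_integrable A g J \<psi>
    \<and> (closed_form A 2 (fundamental_form g J) \<and> closed_form A 3 (re_part \<psi>) \<and> closed_form A 3 (im_part \<psi>))
    \<and> ricci_flat A g"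
proof -
  let ?\<omega> = "fundamental_form g J"
  have metric: "riemannian_metric A g" and J: "almost_complex_structure A J" and \<psi>: "differential_form A 3 \<psi>"
    and coframe: "\<And>c x. c \<in> A \<Longrightarrow> x \<in> chart_image c \<Longrightarrow>
      \<exists>W e. open W \<and> x \<in> W \<and> W \<subseteq> chart_image c \<and> adapted_coframe g J \<psi> c W e"
    using assms(2) unfolding su3_structure_def by blast+
  have \<pi>: "differential_form A 2 \<pi>\<^sub>2"
    and \<pi>_J: "\<And>c x u v. c \<in> A \<Longrightarrow> x \<in> chart_image c \<Longrightarrow> \<pi>\<^sub>2 c x [J c x u, J c x v] = \<pi>\<^sub>2 c x [u, v]"
    and d\<omega>: "closed_form A 2 ?\<omega>" and d\<psi>_im: "closed_form A 3 (im_part \<psi>)"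
    and d\<psi>_re: "tensor_eq A 4 (ext_deriv (re_part \<psi>)) (\<lambda>c x vs. - wedge_field 2 2 \<pi>\<^sub>2 ?\<omega> c x vs)"
    using assms(3) unfolding su3_W2_plus_def Let_def by blast+
  note \<psi>_tensor = \<psi>[unfolded differential_form_def tensor_field_def]
  note \<pi>_tensor = \<pi>[unfolded differential_form_def tensor_field_def]
  have chart: "riemannian_chart g c (chart_image c)" if c: "c \<in> A" for c
  proof
    show "open (chart_image c)" using assms(1) c unfolding smooth_manifold_def by blast
    fix x u v assume x: "x \<in> chart_image c"
    show "multilinear_form 2 (g c x)" "g c x [u, v] = g c x [v, u]" "v \<noteq> 0 \<Longrightarrow> 0 < g c x [v, v]"
      using metric c x unfolding riemannian_metric_def tensor_field_def by blast+
  next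
    fix vs :: "(real^6) list" assume "length vs = 2"
    then show "smooth_map_on (\<lambda>x. g c x vs) (chart_image c)"
      using metric c unfolding riemannian_metric_def tensor_field_def by blast
  qed
  have frame: "\<exists>W e F. su3_frame g c (chart_image c) J \<psi> W e x F" if c: "c \<in> A" and x: "x \<in> chart_image c" for c x
  proof -
    obtain W e where W: "open W" "x \<in> W" "W \<subseteq> chart_image c" "adapted_coframe g J \<psi> c W e"
      using coframe[OF c x] by blast
    then interpret su3_coframe g c "chart_image c" J \<psi> W e
      using chart[OF c] by (simp add: su3_coframe_def su3_coframe_axioms_def)
    obtain F where "\<And>i j. i \<in> {1..6} \<Longrightarrow> j \<in> {1..6} \<Longrightarrow> e i x [F j] = kron i j"
      using dual_frame_exists[OF W(2)] by blast
    then have "su3_frame g c (chart_image c) J \<psi> W e x F"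
      using W(2) by unfold_locales auto
    then show ?thesis by blast
  qed
  have d\<omega>': "ext_deriv ?\<omega> c x [u, v, w] = 0"
    and d\<psi>_im': "ext_deriv (im_part \<psi>) c x [u, v, w, z] = 0"
    and d\<psi>_re': "ext_deriv (re_part \<psi>) c x [u, v, w, z] = - wedge 2 2 (\<pi>\<^sub>2 c x) (?\<omega> c x) [u, v, w, z]"
    and d\<pi>': "ext_deriv \<pi>\<^sub>2 c x [u, v, w] = 0"
    if "c \<in> A" "x \<in> chart_image c" for c x u v w z
    using d\<omega> d\<psi>_im d\<psi>_re assms(4) that unfolding closed_form_def tensor_eq_def wedge_field_def by simp_all
  have \<pi>_zero: "\<pi>\<^sub>2 c x [u, v] = 0" if c: "c \<in> A" and x: "x \<in> chart_image c" for c x u v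
  proof -
    obtain W e F where "su3_frame g c (chart_image c) J \<psi> W e x F" using frame[OF c x] by blast
    then interpret su3_frame g c "chart_image c" J \<psi> W e x F .
    show ?thesis
    proof (rule torsion_form_eq_zero)
      show "(\<lambda>y. J c y v) differentiable (at x)" for v
        using J c x unfolding almost_complex_structure_def
        by (intro smooth_map_on_differentiable[of _ "chart_image c"]) blast+
      show "(\<lambda>y. \<pi>\<^sub>2 c y [u, v]) differentiable (at x)" for u v
        using \<pi>_tensor c x by (intro smooth_map_on_differentiable[of _ "chart_image c"]) simp_all
      show "multilinear_form 2 (\<pi>\<^sub>2 c y)" if "y \<in> chart_image c" for y
        using \<pi>_tensor c that by blast
      show "\<pi>\<^sub>2 c y [u, v] = - \<pi>\<^sub>2 c y [v, u]" if "y \<in> chart_image c" for y u v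
        using \<pi>_tensor c that by (intro alternating_form_2_skew) blast
    qed (rule \<pi>_J[OF c] d\<pi>'[OF c x] d\<omega>'[OF c x] d\<psi>_re'[OF c x] d\<psi>_im'[OF c x], assumption?)+
  qed
  \<comment> \<open>Skewness of \<omega> comes from its normal form in a coframe; it is what allows
    \<open>wedge_2_2\<close> to expand \<pi> \<and> \<omega>.\<close>
  have skew: "?\<omega> c x [u, v] = - ?\<omega> c x [v, u]" if c: "c \<in> A" and x: "x \<in> chart_image c" for c x u v
  proof -
    obtain W e F where "su3_frame g c (chart_image c) J \<psi> W e x F" using frame[OF c x] by blast
    then interpret su3_frame g c "chart_image c" J \<psi> W e x F .
    show ?thesis unfolding fundamental_form_coframe[OF x_W] by (rule sympl_skew)
  qed
  have d\<psi>_re_zero: "ext_deriv (re_part \<psi>) c x [u, v, w, z] = 0"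
    if "c \<in> A" "x \<in> chart_image c" for c x u v w z
    using d\<psi>_re'[OF that] wedge_2_2[of "\<pi>\<^sub>2 c x" "?\<omega> c x", OF _ skew[OF that]] \<pi>_zero[OF
      that] by simp
  have parallel: "cov_deriv g ?\<omega> c x k [u, v] = 0" "cov_deriv g \<psi> c x k [u, v, w] = 0"
    if c: "c \<in> A" and x: "x \<in> chart_image c" for c x k u v w
  proof -
    obtain W e F where "su3_frame g c (chart_image c) J \<psi> W e x F" using frame[OF c x] by blast
    then interpret su3_frame g c "chart_image c" J \<psi> W e x F .
    have "ext_deriv \<psi> c x [a, b, d, f] = 0" for a b d f
      using ext_deriv_re_im_part[of "[a, b, d, f]"] d\<psi>_re_zero[OF c x] d\<psi>_im'[OF c x]
      by (simp add: complex_eq_iff)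
    note parallel_of_closed[OF d\<omega>'[OF c x] this]
    then show "cov_deriv g ?\<omega> c x k [u, v] = 0" "cov_deriv g \<psi> c x k [u, v, w] = 0" by auto
  qed
  \<comment> \<open>For torsion zero the conditions on values and orthogonality are trivial; what
    remains is that \<omega> and \<psi> are parallel.\<close>
  have "su3_integrable A g J \<psi>"
    unfolding su3_integrable_def intrinsic_torsion_def
  proof (intro ballI allI conjI impI)
    fix c x u assume c: "c \<in> A" and x: "x \<in> chart_image c"
    interpret riemannian_chart g c "chart_image c" by (rule chart[OF c])
    show "(\<lambda>v. 0) \<in> so_alg g c x"
      unfolding so_alg_def
      using linear_0[OF metric_linear(1)[OF x]] linear_0[OF metric_linear(2)[OF x]] by (simp add: linear_zero)
    show "trace (matrix ((\<lambda>v. 0) \<circ> E)) = 0" for E :: "real^6 \<Rightarrow> real^6"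
      by (simp add: trace_def matrix_def)
    \<comment> \<open>The action of the zero endomorphism inserts a zero vector in each slot, so it
      vanishes by linearity in that slot.\<close>
    have zero: "T (vs[j := 0]) = 0" if "multilinear_form k T" "length vs = k" "j < k"
      for k j and T :: "(real^6) list \<Rightarrow> 'b::real_vector" and vs
      using that linear_0[of "\<lambda>v. T (vs[j := v])"] unfolding multilinear_form_def by blast
    show "cov_deriv g ?\<omega> c x u vs + endo_act (\<lambda>v. 0) (?\<omega> c x) vs = 0" if len: "length vs = 2" for vs
    proof -
      obtain v w where vs: "vs = [v, w]" using len by (auto simp: length_eq_numeral)
      have "?\<omega> c x [a, 0] = 0" for a
        by (simp add: fundamental_form_def linear_0[OF metric_linear(2)[OF x]])
      then show ?thesis using skew[OF c x, of 0] by (simp add: vs parallel[OF c x] endo_act_2_form)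
    qed
    show "cov_deriv g \<psi> c x u vs + endo_act (\<lambda>v. 0) (\<psi> c x) vs = 0" if "length vs = 3" for vs
    proof -
      have "endo_act (\<lambda>v. 0) (\<psi> c x) vs = 0"
        unfolding endo_act_def using zero[of 3 "\<psi> c x" vs] \<psi>_tensor c x that by simp
      then show ?thesis using that parallel[OF c x] by (auto simp: length_eq_numeral)
    qed
  qed
  moreover have "closed_form A 3 (re_part \<psi>)"
    unfolding closed_form_def tensor_eq_def
  proof (intro ballI allI impI)
    fix c x and vs :: "(real^6) list" assume cx: "c \<in> A" "x \<in> chart_image c" and "length vs = Suc 3"
    then obtain u v w z where "vs = [u, v, w, z]" using length_eq_numeral(3)[of vs] by auto
    then show "ext_deriv (re_part \<psi>) c x vs = 0" using d\<psi>_re_zero[OF cx] by simp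
  qed
  moreover have "ricci_flat A g"
    unfolding ricci_flat_def
  proof (intro ballI allI)
    fix c x j k assume c: "c \<in> A" and x: "x \<in> chart_image c"
    obtain W e F where "su3_frame g c (chart_image c) J \<psi> W e x F" using frame[OF c x] by blast
    then interpret su3_frame g c "chart_image c" J \<psi> W e x F .
    show "ricci g c x j k = 0"
    proof (rule ricci_eq_zero)
      show "linear (J c x)" "J c x (J c x v) = - v" for v
        using J c x unfolding almost_complex_structure_def by blast+
      show "multilinear_form 3 (\<psi> c y)" if "y \<in> chart_image c" for y
        using \<psi>_tensor c that by blast
      show "smooth_map_on (\<lambda>y. \<psi> c y vs) (chart_image c)" if "length vs = 3" for vs
        using \<psi>_tensor c that by blast
      show "cov_deriv g \<psi> c y u vs = 0" if "y \<in> chart_image c" "length vs = 3" for y u vs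
        using parallel(2)[OF c that(1)] that(2) by (auto simp: length_eq_numeral)
    qed
  qed
  ultimately show ?thesis using d\<omega> d\<psi>_im by blast
qed

end
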